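(* Let $\alpha = o(\log n/\log\log n)$, let $m = \mathrm{poly}(n)$, and let $p \geq 1$ be an integer. Any randomized streaming algorithm that makes $p$ passes over any collection of $m$ subsets of $[n]$ presented in a random order stream, and outputs an $\alpha$-approximation to the optimal value of the set cover problem with probability larger than $3/4$ (over the randomness of both the stream order and the algorithm), must use $\widetilde{\Omega}(m n^{1/\alpha}/p)$ space.
   Context: The set cover problem: given a collection of $m$ subsets of the universe $[n]=\{1,\dots,n\}$, the optimal value is the minimum number of sets in the collection whose union is $[n]$. In a random order stream, the $m$ sets arrive one by one in a uniformly random order; a $p$-pass algorithm reads the stream $p$ times. The space is measured in bits. $\widetilde{\Omega}(\cdot)$ hides polylogarithmic factors in $n$; all asymptotic statements are as $n \to \infty$. *)

theory Defs
  imports "HOL-Probability.Probability" "HOL-Combinatorics.Permutations" "HOL-Library.Landau_Symbols"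
begin

text \<open>A p-pass streaming algorithm with shared random seed r (drawn from a discrete
  distribution R). The memory state is a natural number; using s bits of space means
  all memory states are < 2^s. The algorithm may depend on the seed, the pass index,
  and the position in the stream.\<close>
record stream_alg =
  alg_init :: "nat \<Rightarrow> nat"
  alg_step :: "nat \<Rightarrow> nat \<Rightarrow> nat \<Rightarrow> nat set \<Rightarrow> nat \<Rightarrow> nat"
  alg_out  :: "nat \<Rightarrow> nat \<Rightarrow> real"

definition run_pass :: "stream_alg \<Rightarrow> nat \<Rightarrow> nat \<Rightarrow> nat set list \<Rightarrow> nat \<Rightarrow> nat" where
  "run_pass A r j xs q = foldl (\<lambda>q (i, T). alg_step A r j i T q) q (zip [0..<length xs] xs)"

fun run_passes :: "stream_alg \<Rightarrow> nat \<Rightarrow> nat \<Rightarrow> nat set list \<Rightarrow> nat" where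
  "run_passes A r 0 xs = alg_init A r"
| "run_passes A r (Suc j) xs = run_pass A r j xs (run_passes A r j xs)"

definition alg_output :: "stream_alg \<Rightarrow> nat \<Rightarrow> nat \<Rightarrow> nat set list \<Rightarrow> real" where
  "alg_output A r p xs = alg_out A r (run_passes A r p xs)"

definition uses_space :: "stream_alg \<Rightarrow> nat \<Rightarrow> bool" where
  "uses_space A s \<longleftrightarrow> (\<forall>r. alg_init A r < 2 ^ s) \<and>
     (\<forall>r j i T q. q < 2 ^ s \<longrightarrow> alg_step A r j i T q < 2 ^ s)"

definition is_cover :: "nat \<Rightarrow> nat set list \<Rightarrow> nat set \<Rightarrow> bool" where
  "is_cover n S I \<longleftrightarrow> I \<subseteq> {..<length S} \<and> (\<Union>i\<in>I. S ! i) = {1..n}"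

definition set_cover_opt :: "nat \<Rightarrow> nat set list \<Rightarrow> nat" where
  "set_cover_opt n S = Min (card ` {I. is_cover n S I})"

definition is_instance :: "nat \<Rightarrow> nat \<Rightarrow> nat set list \<Rightarrow> bool" where
  "is_instance n m S \<longleftrightarrow> length S = m \<and> (\<forall>T\<in>set S. T \<subseteq> {1..n}) \<and> \<Union>(set S) = {1..n}"

definition random_order :: "nat set list \<Rightarrow> (nat \<Rightarrow> nat) \<Rightarrow> nat set list" where
  "random_order S \<pi> = map (\<lambda>i. S ! \<pi> i) [0..<length S]"

definition order_dist :: "nat \<Rightarrow> (nat \<Rightarrow> nat) pmf" where
  "order_dist m = pmf_of_set {\<pi>. \<pi> permutes {..<m}}"

definition success_prob :: "stream_alg \<Rightarrow> nat pmf \<Rightarrow> nat \<Rightarrow> nat \<Rightarrow> nat set list \<Rightarrow> real \<Rightarrow> real" where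
  "success_prob A R p n S \<alpha> =
     measure_pmf.prob (pair_pmf (order_dist (length S)) R)
       {(\<pi>, r). real (set_cover_opt n S) \<le> alg_output A r p (random_order S \<pi>) \<and>
                alg_output A r p (random_order S \<pi>) \<le> \<alpha> * real (set_cover_opt n S)}"

end

theory Submission
  imports Defs "HOL-Real_Asymp.Real_Asymp"
begin

text \<open>Partition the universe, once for each pair of sets, into \<open>3t \<approx> n\<^bsup>1/\<alpha>\<^esup>\<close> random cells, and let
  the two sets of the pair be the complements of the unions of the cells indexed by \<open>X\<close> and by \<open>Y\<close>. If
  \<open>X\<close> and \<open>Y\<close> are disjoint for some pair, then two sets suffice. If they meet in exactly one
  cell for every pair, then the elements missed by \<open>2\<alpha>\<close> sets are an at least \<open>(3t)\<^bsup>-\<alpha>\<^esup>\<close> fraction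
  of the universe, so with high probability no \<open>2\<alpha>\<close> sets cover it.

  The two situations are indistinguishable in small space. Cut the stream into four blocks; the
  states of the algorithm on entering a block form a transcript of \<open>O(p s)\<close> bits. The level-one
  inequality says that such a transcript hardly depends on a typical one of the \<open>m t\<close> random input
  bits, as measured by the Hellinger distance. For a pair whose two sets lie in different blocks,
  transcripts have the rectangle property, and the cut-and-paste identity turns insensitivity to
  adding one harmless cell into closeness of an intersecting and a disjoint input. A random order
  separates a given pair with probability at least \<open>2/3\<close>, which contradicts a success probability
  above \<open>3/4\<close> unless \<open>p s\<close> is of order \<open>m t\<close>.\<close>

subsection \<open>The level-one inequality\<close>

lemma exp_le_quadratic:
  fixes x :: real
  assumes "\<bar>x\<bar> \<le> 1"
  shows "exp x \<le> 1 + x + x\<^sup>2"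
proof (cases "x \<ge> 0")
  case True
  then show ?thesis using assms exp_bound[of x] by simp
next
  case False
  define y where "y = - x"
  have y: "y > 0" using False by (simp add: y_def)
  \<comment> \<open>The product equals \<open>1 + y ^ 3\<close>.\<close>
  have "1 \<le> (1 + y) * (1 - y + y\<^sup>2)"
    using y by (simp add: algebra_simps power2_eq_square)
  also have "\<dots> \<le> exp y * (1 - y + y\<^sup>2)"
  proof (rule mult_right_mono)
    have "0 \<le> (1 - y)\<^sup>2 + y" using y by simp
    then show "0 \<le> 1 - y + y\<^sup>2" by (simp add: power2_eq_square algebra_simps)
  qed (rule exp_ge_add_one_self)
  finally have "exp (- y) \<le> 1 - y + y\<^sup>2"
    by (simp add: exp_minus field_simps)
  then show ?thesis by (simp add: y_def)
qed

text \<open>The linear terms of the two quadratic bounds cancel. This is the sub-Gaussian estimate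
  for a fair random sign.\<close>

lemma exp_plus_exp_minus_le:
  fixes x :: real
  assumes "\<bar>x\<bar> \<le> 1"
  shows "exp x + exp (- x) \<le> 2 * exp (x\<^sup>2)"
proof -
  have "exp x \<le> 1 + x + x\<^sup>2" "exp (- x) \<le> 1 + (- x) + (- x)\<^sup>2"
    using exp_le_quadratic[of x] exp_le_quadratic[of "- x"] assms by simp_all
  then have "exp x + exp (- x) \<le> 2 * (1 + x\<^sup>2)" by simp
  also have "\<dots> \<le> 2 * exp (x\<^sup>2)" by (intro mult_left_mono exp_ge_add_one_self) simp
  finally show ?thesis .
qed

text \<open>Bits are read as signs, so that the averages of \<open>spin b\<close> over a set of
  inputs are its level-one Fourier coefficients.\<close>

definition spin :: "'b \<Rightarrow> 'b set \<Rightarrow> real" where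
  "spin b W = (if b \<in> W then - 1 else 1)"

text \<open>The signs of a uniform \<open>W\<close> are independent, so the moment generating
  function factorises; \<open>prod_add\<close> is this factorisation.\<close>

lemma sum_exp_spin_le:
  fixes c :: "'b \<Rightarrow> real"
  assumes "finite B" and "\<And>b. b \<in> B \<Longrightarrow> \<bar>c b\<bar> \<le> 1"
  shows "(\<Sum>W\<in>Pow B. exp (\<Sum>b\<in>B. c b * spin b W)) \<le> 2 ^ card B * exp (\<Sum>b\<in>B. (c b)\<^sup>2)"
proof -
  have "(\<Sum>W\<in>Pow B. exp (\<Sum>b\<in>B. c b * spin b W))
      = (\<Sum>W\<in>Pow B. (\<Prod>b\<in>W. exp (- c b)) * (\<Prod>b\<in>B - W. exp (c b)))"
  proof (rule sum.cong[OF refl])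
    fix W assume W: "W \<in> Pow B"
    then have fin: "finite W" using assms(1) finite_subset by auto
    have "(\<Sum>b\<in>B. c b * spin b W) = (\<Sum>b\<in>W. - c b) + (\<Sum>b\<in>B - W. c b)"
      using W assms(1) by (subst sum.subset_diff[of W B]) (auto simp: spin_def add.commute)
    then show "exp (\<Sum>b\<in>B. c b * spin b W) = (\<Prod>b\<in>W. exp (- c b)) * (\<Prod>b\<in>B - W. exp (c b))"
      using fin assms(1) by (simp only: exp_add exp_sum finite_Diff)
  qed
  also have "\<dots> = (\<Prod>b\<in>B. exp (- c b) + exp (c b))"
    using assms(1) by (simp add: prod_add)
  also have "\<dots> \<le> (\<Prod>b\<in>B. 2 * exp ((c b)\<^sup>2))"
    using exp_plus_exp_minus_le assms(2) by (intro prod_mono) (auto simp: add.commute add_nonneg_nonneg)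
  also have "\<dots> = 2 ^ card B * exp (\<Sum>b\<in>B. (c b)\<^sup>2)"
    using assms(1) by (simp add: prod.distrib exp_sum)
  finally show ?thesis .
qed

text \<open>The linear form whose coefficients are the halved biases of \<open>G\<close> has mean
  \<open>c / 2\<close> on \<open>G\<close>. By convexity its exponential averages at least
  \<open>exp (c / 2)\<close> on \<open>G\<close>, but at most \<open>exp (c / 4)\<close> on the
  whole cube; the density of \<open>G\<close> has to account for the ratio.\<close>

lemma level_one_inequality:
  assumes "finite B" and "G \<subseteq> Pow B" and "G \<noteq> {}"
  shows "(\<Sum>b\<in>B. ((\<Sum>W\<in>G. spin b W) / card G)\<^sup>2) \<le> 4 * ln (2 ^ card B / card G)"
proof -
  define \<beta> where "\<beta> = (\<lambda>b. (\<Sum>W\<in>G. spin b W) / card G)"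
  define c where "c = (\<Sum>b\<in>B. (\<beta> b)\<^sup>2)"
  have finG: "finite G" using assms finite_subset by auto
  then have cG: "real (card G) > 0" using assms(3) by (simp add: card_gt_0_iff)
  have beta: "\<bar>\<beta> b\<bar> \<le> 1" for b
  proof -
    have "\<bar>\<Sum>W\<in>G. spin b W\<bar> \<le> (\<Sum>W\<in>G. \<bar>spin b W\<bar>)" by (rule sum_abs)
    also have "\<dots> = card G" by (simp add: spin_def if_distrib cong: if_cong)
    finally show ?thesis using cG by (simp add: \<beta>_def)
  qed
  \<comment> \<open>The scaling by 1/2 is the \<open>z\<close> that maximises
    \<open>z * c - z ^ 2 * c\<close>, the gain on \<open>G\<close> minus the cost on the
    cube.\<close>
  define y where "y = (\<lambda>W. \<Sum>b\<in>B. \<beta> b / 2 * spin b W)"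
  have sumy: "(\<Sum>W\<in>G. y W) = card G * (c / 2)"
  proof -
    have "(\<Sum>W\<in>G. y W) = (\<Sum>b\<in>B. \<beta> b / 2 * (\<Sum>W\<in>G. spin b W))"
      unfolding y_def by (subst sum.swap) (simp add: sum_distrib_left)
    also have "\<dots> = (\<Sum>b\<in>B. card G / 2 * (\<beta> b)\<^sup>2)"
      using cG by (intro sum.cong refl) (simp add: \<beta>_def power2_eq_square)
    finally show ?thesis by (simp add: c_def sum_distrib_left mult.commute)
  qed
  \<comment> \<open>Jensen's inequality through the tangent of \<open>exp\<close> at
    \<open>c / 2\<close>; the first-order terms cancel by \<open>sumy\<close>.\<close>
  have "card G * exp (c / 2) = (\<Sum>W\<in>G. exp (c / 2) * (1 + (y W - c / 2)))"
    unfolding sum_distrib_left[symmetric] sum.distrib sum_subtractf sumy by simp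
  also have "\<dots> \<le> (\<Sum>W\<in>G. exp (c / 2) * exp (y W - c / 2))"
    using exp_ge_add_one_self by (intro sum_mono mult_left_mono) auto
  also have "\<dots> = (\<Sum>W\<in>G. exp (y W))" by (simp add: exp_add[symmetric])
  also have "\<dots> \<le> (\<Sum>W\<in>Pow B. exp (y W))"
    using assms by (intro sum_mono2) auto
  also have "\<dots> \<le> 2 ^ card B * exp (\<Sum>b\<in>B. (\<beta> b / 2)\<^sup>2)"
  proof -
    have "\<bar>\<beta> b / 2\<bar> \<le> 1" for b using beta[of b] by simp
    then show ?thesis unfolding y_def using assms(1) by (intro sum_exp_spin_le) auto
  qed
  also have "(\<Sum>b\<in>B. (\<beta> b / 2)\<^sup>2) = c / 4"
    by (simp add: c_def power_divide sum_divide_distrib)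
  finally have "card G * exp (c / 2) \<le> 2 ^ card B * exp (c / 4)" .
  moreover have "exp (c / 2) = exp (c / 4) * exp (c / 4)" by (simp add: exp_add[symmetric])
  ultimately have "exp (c / 4) \<le> 2 ^ card B / card G"
    using cG by (simp add: field_simps)
  then have "c / 4 \<le> ln (2 ^ card B / card G)"
    using cG by (subst ln_ge_iff) auto
  then show ?thesis by (simp add: c_def \<beta>_def)
qed

section \<open>Laws of functions of uniform bits, entropy, and the influence of a single bit\<close>

definition law :: "'b set \<Rightarrow> ('b set \<Rightarrow> 'c) \<Rightarrow> 'c \<Rightarrow> real" where
  "law B f \<tau> = card {W \<in> Pow B. f W = \<tau>} / 2 ^ card B"

lemma law_nonneg: "law B f \<tau> \<ge> 0"
  by (simp add: law_def)

lemma sum_law: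
  assumes "finite B" "finite P"
  shows "(\<Sum>\<tau>\<in>P. law B f \<tau>) = card {W \<in> Pow B. f W \<in> P} / 2 ^ card B"
proof -
  have "(\<Sum>\<tau>\<in>P. card {W \<in> Pow B. f W = \<tau>}) = card (\<Union>\<tau>\<in>P. {W \<in> Pow B. f W = \<tau>})"
    using assms by (subst card_UN_disjoint) auto
  also have "(\<Union>\<tau>\<in>P. {W \<in> Pow B. f W = \<tau>}) = {W \<in> Pow B. f W \<in> P}" by auto
  finally have "real (\<Sum>\<tau>\<in>P. card {W \<in> Pow B. f W = \<tau>}) = card {W \<in> Pow B. f W \<in> P}" by simp
  then show ?thesis
    unfolding law_def sum_divide_distrib[symmetric] by simp
qed

lemma sum_law_eq_1:
  assumes "finite B" "finite Q" "f \<in> Pow B \<rightarrow> Q"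
  shows "(\<Sum>\<tau>\<in>Q. law B f \<tau>) = 1"
proof -
  have "{W \<in> Pow B. f W \<in> Q} = Pow B" using assms(3) by auto
  then show ?thesis using assms by (simp add: sum_law card_Pow)
qed

text \<open>This is \<open>ln x \<le> x - 1\<close> at
  \<open>x = 1 / (\<mu> \<tau> * card Q)\<close>, averaged with weights
  \<open>\<mu> \<tau>\<close>.\<close>

lemma entropy_le:
  fixes \<mu> :: "'c \<Rightarrow> real"
  assumes "finite Q" "\<And>\<tau>. \<mu> \<tau> \<ge> 0" "sum \<mu> Q = 1"
  shows "(\<Sum>\<tau>\<in>Q. \<mu> \<tau> * ln (1 / \<mu> \<tau>)) \<le> ln (card Q)"
proof -
  have N: "real (card Q) > 0"
    using assms by (metis card_gt_0_iff of_nat_0_less_iff sum.empty zero_neq_one)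
  have "\<mu> \<tau> * ln (1 / \<mu> \<tau>) \<le> 1 / card Q - \<mu> \<tau> + \<mu> \<tau> * ln (card Q)" for \<tau>
  proof (cases "\<mu> \<tau> = 0")
    case False
    then have pos: "\<mu> \<tau> > 0" using assms(2)[of \<tau>] by simp
    have "ln (1 / \<mu> \<tau>) - ln (card Q) = ln (1 / (\<mu> \<tau> * card Q))"
      using pos N by (simp add: ln_div ln_mult)
    also have "\<dots> \<le> 1 / (\<mu> \<tau> * card Q) - 1"
      using pos N by (intro ln_le_minus_one) simp
    finally have "\<mu> \<tau> * (ln (1 / \<mu> \<tau>) - ln (card Q)) \<le> \<mu> \<tau> * (1 / (\<mu> \<tau> * card Q) - 1)"
      using pos by (intro mult_left_mono) auto
    then show ?thesis using pos N by (simp add: algebra_simps)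
  qed (use N in simp)
  then have "(\<Sum>\<tau>\<in>Q. \<mu> \<tau> * ln (1 / \<mu> \<tau>)) \<le> (\<Sum>\<tau>\<in>Q. 1 / card Q - \<mu> \<tau> + \<mu> \<tau> * ln (card Q))"
    by (rule sum_mono)
  also have "\<dots> = ln (card Q)"
    using N assms(3) by (simp add: sum.distrib sum_subtractf sum_distrib_right[symmetric])
  finally show ?thesis .
qed

text \<open>Expanding the square leaves \<open>2 * \<mu> * (1 - sqrt (1 - \<beta>\<^sup>2))\<close>,
  and a number between 0 and 1 is at most its square root.\<close>

lemma sqrt_diff_sq_le:
  fixes \<mu> \<beta> :: real
  assumes "\<mu> \<ge> 0" "\<bar>\<beta>\<bar> \<le> 1"
  shows "(sqrt (\<mu> * (1 + \<beta>)) - sqrt (\<mu> * (1 - \<beta>)))\<^sup>2 \<le> 2 * (\<mu> * \<beta>\<^sup>2)"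
proof -
  have b: "0 \<le> 1 - \<beta>\<^sup>2" "1 - \<beta>\<^sup>2 \<le> 1" using assms(2) by (auto simp: abs_square_le_1)
  have "sqrt (\<mu> * (1 + \<beta>)) * sqrt (\<mu> * (1 - \<beta>)) = \<mu> * sqrt (1 - \<beta>\<^sup>2)"
  proof -
    have "\<mu> * (1 + \<beta>) * (\<mu> * (1 - \<beta>)) = \<mu>\<^sup>2 * (1 - \<beta>\<^sup>2)"
      by (simp add: power2_eq_square algebra_simps)
    then show ?thesis using assms(1) by (simp add: real_sqrt_mult[symmetric] del: real_sqrt_mult)
        (simp add: real_sqrt_mult)
  qed
  moreover have "sqrt (1 - \<beta>\<^sup>2) \<ge> 1 - \<beta>\<^sup>2"
    using b by (metis mult_left_le real_le_rsqrt power2_eq_square)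
  then have "\<mu> * sqrt (1 - \<beta>\<^sup>2) \<ge> \<mu> * (1 - \<beta>\<^sup>2)" using assms(1) by (rule mult_left_mono)
  moreover have "\<mu> * (1 + \<beta>) \<ge> 0" "\<mu> * (1 - \<beta>) \<ge> 0" using assms by auto
  ultimately show ?thesis
    by (simp add: power2_diff) (simp add: algebra_simps)
qed

text \<open>Overwriting bit \<open>b\<close> by a constant amounts to conditioning on that constant.
  Within the fibre of \<open>\<tau>\<close> the bias of bit \<open>b\<close> is
  \<open>\<beta> \<tau>\<close>, which therefore tilts the law by \<open>1 + \<beta> \<tau>\<close>
  or \<open>1 - \<beta> \<tau>\<close>.\<close>

lemma law_split_spin:
  fixes f :: "'b set \<Rightarrow> 'c"
  assumes "finite B" "b \<in> B"
  defines "G \<equiv> \<lambda>\<tau>. {W \<in> Pow B. f W = \<tau>}"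
  defines "\<beta> \<equiv> \<lambda>\<tau>. (\<Sum>W\<in>G \<tau>. spin b W) / card (G \<tau>)"
  shows "law B (\<lambda>W. f (W - {b})) \<tau> = law B f \<tau> * (1 + \<beta> \<tau>)"
    and "law B (\<lambda>W. f (insert b W)) \<tau> = law B f \<tau> * (1 - \<beta> \<tau>)"
proof -
  define G0 where "G0 = {W \<in> G \<tau>. b \<notin> W}"
  define G1 where "G1 = {W \<in> G \<tau>. b \<in> W}"
  have fin: "finite (G \<tau>)" "finite G0" "finite G1" using assms(1) by (auto simp: G_def G0_def G1_def)
  have GU: "G \<tau> = G0 \<union> G1" "G0 \<inter> G1 = {}" by (auto simp: G0_def G1_def)
  have cG: "card (G \<tau>) = card G0 + card G1" using GU fin by (simp add: card_Un_disjoint)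
  have "(\<Sum>W\<in>G \<tau>. spin b W) = (\<Sum>W\<in>G0. spin b W) + (\<Sum>W\<in>G1. spin b W)"
    using GU fin by (simp add: sum.union_disjoint)
  also have "(\<Sum>W\<in>G0. spin b W) = card G0" by (simp add: G0_def spin_def)
  also have "(\<Sum>W\<in>G1. spin b W) = - card G1" by (simp add: G1_def spin_def)
  finally have s: "(\<Sum>W\<in>G \<tau>. spin b W) = real (card G0) - card G1" by simp
  have e0: "{W \<in> Pow B. f (W - {b}) = \<tau>} = G0 \<union> insert b ` G0"
    (is "?L = ?R")
  proof
    show "?L \<subseteq> ?R"
    proof
      fix W assume W: "W \<in> ?L"
      then have "W - {b} \<in> G0" by (auto simp: G0_def G_def)
      then show "W \<in> ?R" by (cases "b \<in> W") (auto simp: insert_absorb intro!: image_eqI[of _ _ "W - {b}"])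
    qed
  qed (use assms(2) in \<open>auto simp: G0_def G_def\<close>)
  have e1: "{W \<in> Pow B. f (insert b W) = \<tau>} = G1 \<union> (\<lambda>W. W - {b}) ` G1"
    (is "?L = ?R")
  proof
    show "?L \<subseteq> ?R"
    proof
      fix W assume W: "W \<in> ?L"
      then have "insert b W \<in> G1" using assms(2) by (auto simp: G1_def G_def)
      then show "W \<in> ?R" by (cases "b \<in> W") (auto simp: insert_absorb intro!: image_eqI[of _ _ "insert b W"])
    qed
  qed (use assms(2) in \<open>auto simp: G1_def G_def insert_absorb\<close>)
  have "inj_on (insert b) G0" by (auto simp: inj_on_def G0_def)
  then have c0: "card {W \<in> Pow B. f (W - {b}) = \<tau>} = 2 * card G0"
    unfolding e0 using fin by (subst card_Un_disjoint) (auto simp: card_image G0_def)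
  have "inj_on (\<lambda>W. W - {b}) G1" by (auto simp: inj_on_def G1_def)
  then have c1: "card {W \<in> Pow B. f (insert b W) = \<tau>} = 2 * card G1"
    unfolding e1 using fin by (subst card_Un_disjoint) (auto simp: card_image G1_def)
  have l0: "law B (\<lambda>W. f (W - {b})) \<tau> = 2 * real (card G0) / 2 ^ card B"
    unfolding law_def c0 by simp
  have l1: "law B (\<lambda>W. f (insert b W)) \<tau> = 2 * real (card G1) / 2 ^ card B"
    unfolding law_def c1 by simp
  have l: "law B f \<tau> = real (card (G \<tau>)) / 2 ^ card B" by (simp add: law_def G_def)
  \<comment> \<open>On an empty fibre \<open>\<beta> \<tau>\<close> is \<open>0 / 0 = 0\<close> and
    all laws involved vanish.\<close>
  have pos: "G0 = {} \<and> G1 = {} \<or> card (G \<tau>) > 0"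
    using fin GU by (auto simp: card_gt_0_iff)
  show "law B (\<lambda>W. f (W - {b})) \<tau> = law B f \<tau> * (1 + \<beta> \<tau>)"
    using pos by (auto simp: l0 l \<beta>_def s cG field_simps)
  show "law B (\<lambda>W. f (insert b W)) \<tau> = law B f \<tau> * (1 - \<beta> \<tau>)"
    using pos by (auto simp: l1 l \<beta>_def s cG field_simps)
qed

text \<open>The Hellinger distance without the customary factor \<open>1 / sqrt 2\<close>: the
  square ranges up to 2.\<close>

definition hel :: "'b set \<Rightarrow> 'c set \<Rightarrow> ('b set \<Rightarrow> 'c) \<Rightarrow> ('b set \<Rightarrow> 'c) \<Rightarrow> real" where
  "hel B Q f g = L2_set (\<lambda>\<tau>. sqrt (law B f \<tau>) - sqrt (law B g \<tau>)) Q"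

lemma hel_nonneg: "hel B Q f g \<ge> 0"
  by (simp add: hel_def)

lemma hel_sq: "(hel B Q f g)\<^sup>2 = (\<Sum>\<tau>\<in>Q. (sqrt (law B f \<tau>) - sqrt (law B g \<tau>))\<^sup>2)"
  by (simp add: hel_def L2_set_def sum_nonneg)

text \<open>The level-one inequality is applied to each fibre of \<open>f\<close>, a set of density
  \<open>law B f \<tau>\<close>. Weighted by these densities, the logarithms add up to the entropy
  of the value of \<open>f\<close>.\<close>

lemma sum_hel_sq_le:
  assumes "finite B" "finite Q" "f \<in> Pow B \<rightarrow> Q"
  shows "(\<Sum>b\<in>B. (hel B Q (\<lambda>W. f (W - {b})) (\<lambda>W. f (insert b W)))\<^sup>2) \<le> 8 * ln (card Q)"
proof -
  define G where "G = (\<lambda>\<tau>. {W \<in> Pow B. f W = \<tau>})"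
  define \<beta> where "\<beta> = (\<lambda>b \<tau>. (\<Sum>W\<in>G \<tau>. spin b W) / card (G \<tau>))"
  have beta: "\<bar>\<beta> b \<tau>\<bar> \<le> 1" for b \<tau>
  proof -
    have "\<bar>\<Sum>W\<in>G \<tau>. spin b W\<bar> \<le> (\<Sum>W\<in>G \<tau>. \<bar>spin b W\<bar>)" by (rule sum_abs)
    also have "\<dots> = card (G \<tau>)" by (simp add: spin_def if_distrib cong: if_cong)
    finally show ?thesis by (simp add: \<beta>_def divide_le_eq)
  qed
  have "(\<Sum>b\<in>B. (hel B Q (\<lambda>W. f (W - {b})) (\<lambda>W. f (insert b W)))\<^sup>2)
      \<le> (\<Sum>b\<in>B. \<Sum>\<tau>\<in>Q. 2 * (law B f \<tau> * (\<beta> b \<tau>)\<^sup>2))"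
    unfolding hel_sq
  proof (intro sum_mono)
    fix b \<tau> assume b: "b \<in> B"
    show "(sqrt (law B (\<lambda>W. f (W - {b})) \<tau>) - sqrt (law B (\<lambda>W. f (insert b W)) \<tau>))\<^sup>2
        \<le> 2 * (law B f \<tau> * (\<beta> b \<tau>)\<^sup>2)"
      using sqrt_diff_sq_le[OF law_nonneg[of B f \<tau>] beta[of b \<tau>]]
      unfolding law_split_spin[OF assms(1) b] \<beta>_def G_def .
  qed
  also have "\<dots> = (\<Sum>\<tau>\<in>Q. 2 * law B f \<tau> * (\<Sum>b\<in>B. (\<beta> b \<tau>)\<^sup>2))"
    by (subst sum.swap) (simp add: sum_distrib_left mult.assoc)
  also have "\<dots> \<le> (\<Sum>\<tau>\<in>Q. 2 * law B f \<tau> * (4 * ln (1 / law B f \<tau>)))"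
  proof (rule sum_mono)
    fix \<tau>
    show "2 * law B f \<tau> * (\<Sum>b\<in>B. (\<beta> b \<tau>)\<^sup>2) \<le> 2 * law B f \<tau> * (4 * ln (1 / law B f \<tau>))"
    proof (cases "G \<tau> = {}")
      case True
      then have "law B f \<tau> = 0" unfolding law_def G_def by (simp only: card.empty)
      then show ?thesis by simp
    next
      case False
      have "1 / law B f \<tau> = 2 ^ card B / card (G \<tau>)" by (simp add: law_def G_def)
      moreover have "(\<Sum>b\<in>B. (\<beta> b \<tau>)\<^sup>2) \<le> 4 * ln (2 ^ card B / card (G \<tau>))"
        unfolding \<beta>_def using False assms(1) by (intro level_one_inequality) (auto simp: G_def)
      ultimately show ?thesis using law_nonneg[of B f \<tau>] by (intro mult_left_mono) auto
    qed
  qed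
  also have "\<dots> = 8 * (\<Sum>\<tau>\<in>Q. law B f \<tau> * ln (1 / law B f \<tau>))"
    by (simp add: sum_distrib_left mult_ac)
  also have "\<dots> \<le> 8 * ln (card Q)"
    using entropy_le[OF assms(2) law_nonneg sum_law_eq_1[OF assms]] by simp
  finally show ?thesis .
qed

subsection \<open>Hellinger distance and cut-and-paste\<close>

lemma hel_commute: "hel B Q f g = hel B Q g f"
  by (simp add: hel_def L2_set_def power2_commute)

lemma hel_triangle: "hel B Q f h \<le> hel B Q f g + hel B Q g h"
  using L2_set_triangle_ineq[of "\<lambda>\<tau>. sqrt (law B f \<tau>) - sqrt (law B g \<tau>)"
      "\<lambda>\<tau>. sqrt (law B g \<tau>) - sqrt (law B h \<tau>)" Q]
  by (simp add: hel_def)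

text \<open>Both laws have mass 1, so the distance depends only on the products
  \<open>law B f \<tau> * law B g \<tau>\<close>. That is all that cut-and-paste has to
  preserve.\<close>

lemma hel_sq_affinity:
  assumes "finite B" "finite Q" "f \<in> Pow B \<rightarrow> Q" "g \<in> Pow B \<rightarrow> Q"
  shows "(hel B Q f g)\<^sup>2 = 2 - 2 * (\<Sum>\<tau>\<in>Q. sqrt (law B f \<tau> * law B g \<tau>))"
proof -
  have "(hel B Q f g)\<^sup>2 = (\<Sum>\<tau>\<in>Q. law B f \<tau> + law B g \<tau> - 2 * sqrt (law B f \<tau> * law B g \<tau>))"
    unfolding hel_sq by (intro sum.cong refl) (simp add: power2_diff law_nonneg real_sqrt_mult)
  then show ?thesis
    using sum_law_eq_1[OF assms(1,2,3)] sum_law_eq_1[OF assms(1,2,4)]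
    by (simp add: sum.distrib sum_subtractf sum_distrib_left)
qed

text \<open>Total variation is controlled by the Hellinger distance: factor each difference of laws
  as a difference times a sum of square roots and apply the Cauchy-Schwarz inequality.\<close>

lemma sum_law_diff_le:
  assumes "finite B" "finite Q" "f \<in> Pow B \<rightarrow> Q" "g \<in> Pow B \<rightarrow> Q" "P \<subseteq> Q"
  shows "(\<Sum>\<tau>\<in>P. law B f \<tau>) - (\<Sum>\<tau>\<in>P. law B g \<tau>) \<le> 2 * hel B Q f g"
proof -
  let ?f = "\<lambda>\<tau>. sqrt (law B f \<tau>)" and ?g = "\<lambda>\<tau>. sqrt (law B g \<tau>)"
  have sq: "(?f \<tau>)\<^sup>2 = law B f \<tau>" "(?g \<tau>)\<^sup>2 = law B g \<tau>" for \<tau>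
    by (simp_all add: law_nonneg)
  have "(\<Sum>\<tau>\<in>P. law B f \<tau>) - (\<Sum>\<tau>\<in>P. law B g \<tau>) = (\<Sum>\<tau>\<in>P. law B f \<tau> - law B g \<tau>)"
    by (simp add: sum_subtractf)
  also have "\<dots> \<le> (\<Sum>\<tau>\<in>P. \<bar>law B f \<tau> - law B g \<tau>\<bar>)" by (intro sum_mono) simp
  also have "\<dots> \<le> (\<Sum>\<tau>\<in>Q. \<bar>law B f \<tau> - law B g \<tau>\<bar>)"
    using assms by (intro sum_mono2) auto
  also have "\<dots> = (\<Sum>\<tau>\<in>Q. \<bar>?f \<tau> - ?g \<tau>\<bar> * \<bar>?f \<tau> + ?g \<tau>\<bar>)"
  proof (intro sum.cong refl)
    fix \<tau>
    have "law B f \<tau> - law B g \<tau> = (?f \<tau> - ?g \<tau>) * (?f \<tau> + ?g \<tau>)"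
      using square_diff_square_factored[of "?f \<tau>" "?g \<tau>"] sq[of \<tau>]
      by (simp only: power2_eq_square mult.commute)
    then show "\<bar>law B f \<tau> - law B g \<tau>\<bar> = \<bar>?f \<tau> - ?g \<tau>\<bar> * \<bar>?f \<tau> + ?g \<tau>\<bar>"
      by (simp only: abs_mult)
  qed
  also have "\<dots> \<le> hel B Q f g * L2_set (\<lambda>\<tau>. ?f \<tau> + ?g \<tau>) Q"
    unfolding hel_def by (rule L2_set_mult_ineq)
  also have "\<dots> \<le> hel B Q f g * 2"
  proof (rule mult_left_mono[OF _ hel_nonneg])
    have "L2_set (\<lambda>\<tau>. ?f \<tau> + ?g \<tau>) Q \<le> L2_set ?f Q + L2_set ?g Q" by (rule L2_set_triangle_ineq)
    also have "L2_set ?f Q = 1" unfolding L2_set_def sq using sum_law_eq_1[OF assms(1-3)] by simp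
    also have "L2_set ?g Q = 1" unfolding L2_set_def sq using sum_law_eq_1[OF assms(1,2,4)] by simp
    finally show "L2_set (\<lambda>\<tau>. ?f \<tau> + ?g \<tau>) Q \<le> 2" by simp
  qed
  finally show ?thesis by simp
qed

text \<open>A two-player view: one player holds \<open>x\<close> and the random bits in
  \<open>B1\<close>, the other holds \<open>y\<close> and the remaining bits. \<open>Tr_mix\<close>
  says that inputs with equal transcripts may exchange one player's share without changing the
  transcript.\<close>

locale rectangle_property =
  fixes B B1 :: "'b set" and Q :: "'c set" and Tr :: "'x \<Rightarrow> 'x \<Rightarrow> 'b set \<Rightarrow> 'c"
  assumes finite_bits: "finite B" and finite_values: "finite Q"
    and Tr_in: "Tr x y \<in> Pow B \<rightarrow> Q"
    and Tr_mix: "W \<subseteq> B \<Longrightarrow> W' \<subseteq> B \<Longrightarrow> Tr x y W = Tr x' y' W' \<Longrightarrow>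
          Tr x y' ((W \<inter> B1) \<union> (W' - B1)) = Tr x y W"
begin

text \<open>Exchanging the shares outside \<open>B1\<close> maps pairs of bit sets for the left side
  injectively to pairs for the right side, since doing it twice restores the original pair.\<close>

lemma law_mult_le: "law B (Tr x y) \<tau> * law B (Tr x' y') \<tau> \<le> law B (Tr x y') \<tau> * law B (Tr x' y) \<tau>"
proof -
  define mx where "mx = (\<lambda>W W'. (W \<inter> B1) \<union> (W' - B1) :: 'b set)"
  have mxmx: "mx (mx V V') (mx V' V) = V" for V V' by (auto simp: mx_def)
  let ?S = "\<lambda>x y. {W \<in> Pow B. Tr x y W = \<tau>}"
  have "card (?S x y \<times> ?S x' y') \<le> card (?S x y' \<times> ?S x' y)"
  proof (rule card_inj_on_le[where f = "\<lambda>(W, W'). (mx W W', mx W' W)"])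
    show "inj_on (\<lambda>(W, W'). (mx W W', mx W' W)) (?S x y \<times> ?S x' y')"
    proof (rule inj_on_inverseI[where g = "\<lambda>(W, W'). (mx W W', mx W' W)"])
      show "(\<lambda>(W, W'). (mx W W', mx W' W)) ((\<lambda>(W, W'). (mx W W', mx W' W)) p) = p" for p
        by (cases p) (simp only: prod.case mxmx)
    qed
    show "(\<lambda>(W, W'). (mx W W', mx W' W)) ` (?S x y \<times> ?S x' y') \<subseteq> ?S x y' \<times> ?S x' y"
    proof (rule image_subsetI)
      fix w assume "w \<in> ?S x y \<times> ?S x' y'"
      then obtain W W' where w: "w = (W, W')"
        and W: "W \<subseteq> B" "W' \<subseteq> B" "Tr x y W = \<tau>" "Tr x' y' W' = \<tau>" by auto
      show "(\<lambda>(W, W'). (mx W W', mx W' W)) w \<in> ?S x y' \<times> ?S x' y"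
      proof -
        have "Tr x y' (mx W W') = \<tau>"
          using Tr_mix[OF W(1,2), of x y x' y'] W(3,4) by (simp only: mx_def)
        moreover have "Tr x' y (mx W' W) = \<tau>"
          using Tr_mix[OF W(2,1), of x' y' x y] W(3,4) by (simp only: mx_def)
        moreover have "mx W W' \<subseteq> B" "mx W' W \<subseteq> B" using W(1,2) by (auto simp: mx_def)
        ultimately show ?thesis by (simp add: w)
      qed
    qed
    show "finite (?S x y' \<times> ?S x' y)" using finite_bits by simp
  qed
  then have "card (?S x y) * card (?S x' y') \<le> card (?S x y') * card (?S x' y)"
    by (simp only: card_cartesian_product)
  then have "real (card (?S x y)) * card (?S x' y') \<le> real (card (?S x y')) * card (?S x' y)"
    by (simp only: of_nat_mult[symmetric] of_nat_le_iff)
  then show ?thesis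
    unfolding law_def times_divide_times_eq by (intro divide_right_mono) auto
qed

text \<open>\<open>law_mult_le\<close> holds in both directions, so the products of laws agree, and
  they determine the distance.\<close>

lemma hel_cut_paste: "hel B Q (Tr x y) (Tr x' y') = hel B Q (Tr x y') (Tr x' y)"
proof -
  have "law B (Tr x y) \<tau> * law B (Tr x' y') \<tau> = law B (Tr x y') \<tau> * law B (Tr x' y) \<tau>" for \<tau>
    by (intro antisym law_mult_le)
  then have "(hel B Q (Tr x y) (Tr x' y'))\<^sup>2 = (hel B Q (Tr x y') (Tr x' y))\<^sup>2"
    by (simp add: hel_sq_affinity finite_bits finite_values Tr_in)
  then show ?thesis by (simp add: hel_nonneg)
qed

text \<open>Here \<open>a\<close> and \<open>b\<close> are inputs with a single common element \<open>e\<close>, respectively \<open>j\<close>, and \<open>c\<close>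
  is the input with both: if adding a harmless element never shows, then the inputs \<open>(a, a)\<close>, which
  intersect, look like \<open>(a, b)\<close>, which do not.\<close>

lemma hel_intersecting_disjoint:
  assumes "hel B Q (Tr a a) (Tr c a) \<le> d" "hel B Q (Tr a a) (Tr a c) \<le> d"
    and "hel B Q (Tr b b) (Tr c b) \<le> d" "hel B Q (Tr b b) (Tr b c) \<le> d"
  shows "hel B Q (Tr a a) (Tr a b) \<le> 8 * d"
proof -
  let ?h = "\<lambda>x y x' y'. hel B Q (Tr x y) (Tr x' y')"
  have aacc: "?h a a c c \<le> 2 * d"
  proof -
    have "?h a a c c = ?h a c c a" by (rule hel_cut_paste)
    also have "\<dots> \<le> ?h a c a a + ?h a a c a" by (rule hel_triangle)
    finally show ?thesis using assms(1,2) hel_commute[of B Q "Tr a c" "Tr a a"] by simp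
  qed
  have bbcc: "?h b b c c \<le> 2 * d"
  proof -
    have "?h b b c c = ?h b c c b" by (rule hel_cut_paste)
    also have "\<dots> \<le> ?h b c b b + ?h b b c b" by (rule hel_triangle)
    finally show ?thesis using assms(3,4) hel_commute[of B Q "Tr b c" "Tr b b"] by simp
  qed
  \<comment> \<open>The path from \<open>(a, c)\<close> to \<open>(c, b)\<close> runs through
    \<open>(a, a)\<close>, \<open>(c, c)\<close> and \<open>(b, b)\<close>, with legs
    \<open>d\<close>, \<open>2 * d\<close>, \<open>2 * d\<close> and \<open>d\<close>.\<close>
  have "?h a b c c = ?h a c c b" by (rule hel_cut_paste)
  also have "\<dots> \<le> ?h a c a a + ?h a a c b" by (rule hel_triangle)
  also have "?h a a c b \<le> ?h a a c c + ?h c c c b" by (rule hel_triangle)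
  also have "?h c c c b \<le> ?h c c b b + ?h b b c b" by (rule hel_triangle)
  finally have "?h a b c c \<le> 6 * d"
    using aacc bbcc assms hel_commute[of B Q "Tr a c" "Tr a a"] hel_commute[of B Q "Tr c c" "Tr b b"]
    by simp
  then show ?thesis
    using aacc hel_triangle[of B Q "Tr a a" "Tr a b" "Tr c c"] hel_commute[of B Q "Tr c c" "Tr a b"]
    by simp
qed

end

subsection \<open>Transcripts of streaming algorithms\<close>

text \<open>All passes run on one clock: time \<open>n\<close> is position \<open>n mod m\<close> of
  pass \<open>n div m\<close>. A statement about all passes then needs a single induction.\<close>

primrec state_at :: "stream_alg \<Rightarrow> nat \<Rightarrow> nat \<Rightarrow> (nat \<Rightarrow> nat set) \<Rightarrow> nat \<Rightarrow> nat" where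
  "state_at A r m X 0 = alg_init A r"
| "state_at A r m X (Suc n) = alg_step A r (n div m) (n mod m) (X (n mod m)) (state_at A r m X n)"

lemma state_at_less:
  assumes "uses_space A s"
  shows "state_at A r m X n < 2 ^ s"
  using assms by (induction n) (auto simp: uses_space_def)

lemma run_pass_state_at:
  assumes "q \<le> m"
  shows "run_pass A r j (map X [0..<q]) (state_at A r m X (j * m)) = state_at A r m X (j * m + q)"
  using assms
proof (induction q)
  case 0
  then show ?case by (simp add: run_pass_def)
next
  case (Suc q)
  have "run_pass A r j (map X [0..<Suc q]) (state_at A r m X (j * m))
     = alg_step A r j q (X q) (run_pass A r j (map X [0..<q]) (state_at A r m X (j * m)))"
    by (simp add: run_pass_def)
  with Suc show ?case by simp
qed

lemma run_passes_state_at: "run_passes A r p (map X [0..<m]) = state_at A r m X (p * m)"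
  by (induction p) (simp_all add: run_pass_state_at add.commute)

lemma alg_output_state_at: "alg_output A r p (map X [0..<m]) = alg_out A r (state_at A r m X (p * m))"
  by (simp add: alg_output_def run_passes_state_at)

text \<open>The positions of the stream are cut into at most four blocks of length \<open>h = m div 4 + 1\<close>.
  Checkpoints are the times at which the algorithm enters a block.\<close>

definition checkpoints :: "nat \<Rightarrow> nat \<Rightarrow> nat set" where
  "checkpoints m p = {n. n < (p + 1) * m \<and> (m div 4 + 1) dvd n mod m}"

lemma finite_checkpoints: "finite (checkpoints m p)"
  by (simp add: checkpoints_def)

text \<open>Since \<open>4 * (m div 4 + 1)\<close> exceeds \<open>m\<close>, every pass has at most
  four checkpoints. The range extends over \<open>p + 1\<close> passes so that the final time
  \<open>p * m\<close> is a checkpoint too.\<close>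

lemma card_checkpoints_le: "card (checkpoints m p) \<le> 4 * (p + 1)"
proof -
  let ?h = "m div 4 + 1"
  have "checkpoints m p \<subseteq> (\<lambda>(c, b). c * m + b * ?h) ` ({..p} \<times> {..<4})"
  proof
    fix n assume n: "n \<in> checkpoints m p"
    then have m: "m > 0" by (auto simp: checkpoints_def intro: Nat.gr0I)
    define b where "b = n mod m div ?h"
    have b: "n mod m = b * ?h" unfolding b_def using n by (simp only: checkpoints_def mem_Collect_eq dvd_div_mult_self)
    have "b < 4"
    proof (rule ccontr)
      assume "\<not> b < 4"
      then have "4 * ?h \<le> n mod m" unfolding b by (intro mult_right_mono) auto
      moreover have "n mod m < m" using m by simp
      ultimately show False by simp
    qed
    moreover have "n div m \<le> p"
      using n m by (auto simp: checkpoints_def less_Suc_eq_le[symmetric] div_less_iff_less_mult)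
    moreover have "n = (n div m) * m + b * ?h" unfolding b[symmetric] by simp
    ultimately show "n \<in> (\<lambda>(c, b). c * m + b * ?h) ` ({..p} \<times> {..<4})"
      by (intro image_eqI[of _ _ "(n div m, b)"]) auto
  qed
  then have "card (checkpoints m p) \<le> card ({..p} \<times> {..<4::nat})"
    by (rule surj_card_le[rotated]) simp
  then show ?thesis by simp
qed

definition block :: "nat \<Rightarrow> nat \<Rightarrow> nat" where
  "block m q = q div (m div 4 + 1)"

text \<open>Restriction makes transcripts extensional, so they lie in a finite function space that
  can be counted.\<close>

definition transcript :: "stream_alg \<Rightarrow> nat \<Rightarrow> nat \<Rightarrow> nat \<Rightarrow> (nat \<Rightarrow> nat set) \<Rightarrow> nat \<Rightarrow> nat" where
  "transcript A r m p X = restrict (state_at A r m X) (checkpoints m p)"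

definition transcripts :: "nat \<Rightarrow> nat \<Rightarrow> nat \<Rightarrow> (nat \<Rightarrow> nat) set" where
  "transcripts m p s = checkpoints m p \<rightarrow>\<^sub>E {..<2 ^ s}"

lemma transcript_in: "uses_space A s \<Longrightarrow> transcript A r m p X \<in> transcripts m p s"
  by (auto simp: transcript_def transcripts_def state_at_less)

lemma finite_transcripts: "finite (transcripts m p s)"
  by (simp add: transcripts_def finite_checkpoints finite_PiE)

text \<open>There are at most \<open>4 * (p + 1) \<le> 8 * p\<close> checkpoints with
  \<open>s\<close> bits each, and \<open>ln 2 \<le> 1\<close>.\<close>

lemma ln_card_transcripts:
  assumes "p \<ge> 1"
  shows "ln (card (transcripts m p s)) \<le> 8 * real p * real s"
proof -
  have "card (transcripts m p s) = (2 ^ s) ^ card (checkpoints m p)"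
    by (simp add: transcripts_def card_PiE finite_checkpoints)
  then have "ln (card (transcripts m p s)) = real (card (checkpoints m p)) * (real s * ln 2)"
    by (simp add: ln_realpow)
  also have "\<dots> \<le> (8 * real p) * (real s * 1)"
  proof (intro mult_mono)
    have "card (checkpoints m p) \<le> 8 * p" using card_checkpoints_le[of m p] assms by (simp add: algebra_simps)
    then show "real (card (checkpoints m p)) \<le> 8 * real p" by linarith
    show "ln 2 \<le> (1::real)" using ln_le_minus_one[of 2] by simp
  qed auto
  finally show ?thesis by simp
qed

lemma transcript_final:
  assumes "m > 0"
  shows "transcript A r m p X (p * m) = state_at A r m X (p * m)"
  using assms by (simp add: transcript_def checkpoints_def)

text \<open>Inside a block the run on \<open>Z\<close> imitates the run on \<open>X\<close> or on
  \<open>Y\<close>. At a block boundary those two runs are in the same state, so it may change from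
  one to the other.\<close>

lemma transcript_mix:
  assumes eq: "transcript A r m p X = transcript A r m p Y"
    and X: "\<And>q. q < m \<Longrightarrow> block m q = u \<Longrightarrow> Z q = X q"
    and Y: "\<And>q. q < m \<Longrightarrow> block m q \<noteq> u \<Longrightarrow> Z q = Y q"
  shows "transcript A r m p Z = transcript A r m p X"
proof -
  let ?h = "m div 4 + 1"
  have eqc: "state_at A r m X n = state_at A r m Y n" if "n \<in> checkpoints m p" for n
    using fun_cong[OF eq, of n] that by (simp add: transcript_def)
  \<comment> \<open>The choice between \<open>X\<close> and \<open>Y\<close> is made by the block of
    the position about to be read, \<open>n mod m\<close>.\<close>
  have inv: "state_at A r m Z n = state_at A r m (if block m (n mod m) = u then X else Y) n"
    if "n < (p + 1) * m" for n
    using that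
  proof (induction n)
    case 0
    then show ?case by simp
  next
    case (Suc n)
    have m: "m > 0" using Suc.prems by (auto intro: Nat.gr0I)
    define V where "V = (if block m (n mod m) = u then X else Y)"
    have "state_at A r m Z n = state_at A r m V n" using Suc by (simp add: V_def)
    moreover have "Z (n mod m) = V (n mod m)" using X[of "n mod m"] Y[of "n mod m"] m by (simp add: V_def)
    ultimately have ZV: "state_at A r m Z (Suc n) = state_at A r m V (Suc n)" by simp
    show ?case
    proof (cases "Suc n \<in> checkpoints m p")
      case True
      then show ?thesis using ZV eqc by (auto simp: V_def simp del: state_at.simps)
    next
      case False
      then have nd: "\<not> ?h dvd Suc n mod m" using Suc.prems by (simp add: checkpoints_def)
      then have "Suc n mod m \<noteq> 0" by (metis dvd_0_right)
      then have s: "Suc n mod m = Suc (n mod m)" by (simp add: mod_Suc split: if_splits)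
      \<comment> \<open>Away from checkpoints no boundary is crossed, so the imitated run stays the
        same.\<close>
      have "block m (Suc n mod m) = block m (n mod m)"
        using nd unfolding block_def s by (simp add: div_Suc dvd_eq_mod_eq_0)
      then show ?thesis using ZV by (simp add: V_def)
    qed
  qed
  show ?thesis
  proof
    fix n
    show "transcript A r m p Z n = transcript A r m p X n"
    proof (cases "n \<in> checkpoints m p")
      case True
      then show ?thesis using inv[of n] eqc[of n] by (auto simp: transcript_def checkpoints_def)
    qed (simp add: transcript_def)
  qed
qed

subsection \<open>Averaging over single bits\<close>

text \<open>The map \<open>insert b\<close> is at most two-to-one.\<close>

lemma sum_Pow_insert_le:
  fixes f :: "'b set \<Rightarrow> real"
  assumes "finite B" "b \<in> B" "\<And>D. f D \<ge> 0"
  shows "(\<Sum>D\<in>Pow B. f (insert b D)) \<le> 2 * (\<Sum>D\<in>Pow B. f D)"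
proof -
  let ?P1 = "{D \<in> Pow B. b \<in> D}" and ?P0 = "{D \<in> Pow B. b \<notin> D}"
  have P: "Pow B = ?P1 \<union> ?P0" "?P1 \<inter> ?P0 = {}" by auto
  have fin: "finite ?P1" "finite ?P0" using assms(1) by auto
  have "(\<Sum>D\<in>?P1. f (insert b D)) = (\<Sum>D\<in>?P1. f D)"
    by (intro sum.cong refl) (auto simp: insert_absorb)
  also have "\<dots> \<le> (\<Sum>D\<in>Pow B. f D)" using assms by (intro sum_mono2) auto
  finally have 1: "(\<Sum>D\<in>?P1. f (insert b D)) \<le> (\<Sum>D\<in>Pow B. f D)" .
  have "inj_on (insert b) ?P0" by (auto simp: inj_on_def)
  then have "(\<Sum>D\<in>?P0. f (insert b D)) = (\<Sum>D\<in>insert b ` ?P0. f D)" by (simp add: sum.reindex)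
  also have "\<dots> \<le> (\<Sum>D\<in>Pow B. f D)" using assms by (intro sum_mono2) auto
  finally have 2: "(\<Sum>D\<in>?P0. f (insert b D)) \<le> (\<Sum>D\<in>Pow B. f D)" .
  have "(\<Sum>D\<in>Pow B. f (insert b D)) = (\<Sum>D\<in>?P1. f (insert b D)) + (\<Sum>D\<in>?P0. f (insert b D))"
    by (subst P(1)) (rule sum.union_disjoint[OF fin P(2)])
  with 1 2 show ?thesis by simp
qed

text \<open>Complementation in \<open>B\<close> turns removal of \<open>b\<close> into
  insertion.\<close>

lemma sum_Pow_remove_le:
  fixes f :: "'b set \<Rightarrow> real"
  assumes "finite B" "b \<in> B" "\<And>D. f D \<ge> 0"
  shows "(\<Sum>D\<in>Pow B. f (D - {b})) \<le> 2 * (\<Sum>D\<in>Pow B. f D)"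
proof -
  have "(\<Sum>D\<in>Pow B. f D) = (\<Sum>D\<in>Pow B. f (B - D))" for f :: "'b set \<Rightarrow> real"
    by (rule sum.reindex_bij_witness[of _ "\<lambda>D. B - D" "\<lambda>D. B - D"]) (auto simp: double_diff)
  note compl = this
  have "(\<Sum>D\<in>Pow B. f (D - {b})) = (\<Sum>D\<in>Pow B. f (B - insert b D))"
    by (subst compl) (intro sum.cong refl arg_cong[of _ _ f], auto)
  also have "\<dots> \<le> 2 * (\<Sum>D\<in>Pow B. f (B - D))"
    using assms by (intro sum_Pow_insert_le[of B b "\<lambda>D. f (B - D)"]) auto
  finally show ?thesis by (simp only: compl[symmetric, of f])
qed

text \<open>Resampling one coordinate preserves the uniform distribution: exchanging
  \<open>e\<close> with \<open>v i\<close> is an involution on the pairs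
  \<open>(e, v)\<close>.\<close>

lemma sum_PiE_fun_upd:
  fixes f :: "('i \<Rightarrow> 'a) \<Rightarrow> real"
  assumes "finite I" "finite X" "i \<in> I"
  shows "(\<Sum>e\<in>X. \<Sum>v\<in>I \<rightarrow>\<^sub>E X. f (v(i := e))) = card X * (\<Sum>v\<in>I \<rightarrow>\<^sub>E X. f v)"
proof -
  have "(\<Sum>e\<in>X. \<Sum>v\<in>I \<rightarrow>\<^sub>E X. f (v(i := e))) = (\<Sum>(e, v)\<in>X \<times> (I \<rightarrow>\<^sub>E X). f (v(i := e)))"
    by (simp add: sum.cartesian_product)
  also have "\<dots> = (\<Sum>(e, v)\<in>X \<times> (I \<rightarrow>\<^sub>E X). f v)"
    by (rule sum.reindex_bij_witness[of _ "\<lambda>(e, v). (v i, v(i := e))" "\<lambda>(e, v). (v i, v(i := e))"])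
       (use assms(3) in \<open>auto simp: PiE_iff extensional_def\<close>)
  also have "\<dots> = card X * (\<Sum>v\<in>I \<rightarrow>\<^sub>E X. f v)"
    by (simp add: sum.cartesian_product[symmetric])
  finally show ?thesis .
qed

subsection \<open>The hard instances\<close>

text \<open>\<open>cells t D F W l\<close> are the cells missing from set \<open>l\<close>; sets \<open>2i\<close> and \<open>2i + 1\<close> form a pair. \<open>F l\<close> is forced.
  The random bits \<open>W\<close> count only for the member of the pair selected by \<open>D\<close>: given \<open>D\<close>, the two members
  are independent and yet never share a random cell. The cells from \<open>t\<close> on make every single set miss
  at least a third of the cells.\<close>

definition cells ::
  "nat \<Rightarrow> (nat \<times> nat) set \<Rightarrow> (nat \<Rightarrow> nat set) \<Rightarrow> (nat \<times> nat) set \<Rightarrow> nat \<Rightarrow> nat set" where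
  "cells t D F W l = F l \<union> {k. k < t \<and> (l, k) \<in> W \<and> ((l div 2, k) \<in> D \<longleftrightarrow> even l)}
     \<union> (if even l then {t..<2 * t} else {2 * t..<3 * t})"

text \<open>The label of \<open>x\<close> is indexed by \<open>l div 2\<close>: the two members of a
  pair share a partition, and different pairs have their own.\<close>

definition cutset :: "nat \<Rightarrow> (nat \<Rightarrow> nat \<Rightarrow> nat) \<Rightarrow> (nat \<Rightarrow> nat set) \<Rightarrow> nat \<Rightarrow> nat set" where
  "cutset n g C l = {x \<in> {1..n}. g x (l div 2) \<notin> C l}"

definition common :: "(nat \<Rightarrow> nat) \<Rightarrow> nat \<Rightarrow> nat set" where
  "common v l = {v (l div 2)}"

text \<open>\<open>x\<close> and \<open>y\<close> are the inputs of the two players: equal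
  singletons keep pair \<open>i\<close> intersecting, distinct ones make it disjoint.\<close>

definition planted :: "nat \<Rightarrow> nat set \<Rightarrow> nat set \<Rightarrow> (nat \<Rightarrow> nat) \<Rightarrow> nat \<Rightarrow> nat set" where
  "planted i x y v = (common v)(2 * i := x, 2 * i + 1 := y)"

text \<open>Erasing the random bits of pair \<open>i\<close> at \<open>e\<close> and
  \<open>j\<close> leaves these two cells to the planted inputs alone.\<close>

definition cleared :: "nat \<Rightarrow> nat \<Rightarrow> nat \<Rightarrow> (nat \<times> nat) set \<Rightarrow> (nat \<times> nat) set" where
  "cleared i e j W = W - {2 * i, 2 * i + 1} \<times> {e, j}"

lemma div_2_eq_iff: "l div 2 = i \<longleftrightarrow> l = 2 * i \<or> l = 2 * i + 1" for l i :: nat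
  by presburger

lemma pair_index_cases:
  fixes l i :: nat
  obtains "l = 2 * i" | "l = 2 * i + 1" | "l \<noteq> 2 * i" "l \<noteq> 2 * i + 1" "l div 2 \<noteq> i"
  using div_2_eq_iff by blast

text \<open>Putting \<open>(i, j)\<close> into \<open>D\<close> gives cell \<open>j\<close> to the
  even member, taking it out gives it to the odd one. One random bit then decides whether
  \<open>j\<close> is added to that member only. The bits at \<open>e\<close> have no effect because
  \<open>e\<close> is forced in both members, so planting \<open>j\<close> is the same as flipping a
  single bit.\<close>

lemma cells_planted:
  assumes "e \<noteq> j" "e < t" "j < t"
  shows "cells t (insert (i, j) D) (common (v(i := e))) (W - {(2 * i, j)})
          = cells t D (planted i {e} {e} v) (cleared i e j W)"
    and "cells t (insert (i, j) D) (common (v(i := e))) (insert (2 * i, j) W)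
          = cells t D (planted i {e, j} {e} v) (cleared i e j W)"
    and "cells t (D - {(i, j)}) (common (v(i := e))) (W - {(2 * i + 1, j)})
          = cells t D (planted i {e} {e} v) (cleared i e j W)"
    and "cells t (D - {(i, j)}) (common (v(i := e))) (insert (2 * i + 1, j) W)
          = cells t D (planted i {e} {e, j} v) (cleared i e j W)"
proof -
  note defs = cells_def common_def planted_def cleared_def
  show "cells t (insert (i, j) D) (common (v(i := e))) (W - {(2 * i, j)})
          = cells t D (planted i {e} {e} v) (cleared i e j W)"
  proof (rule ext)
    fix l show "cells t (insert (i, j) D) (common (v(i := e))) (W - {(2 * i, j)}) l
          = cells t D (planted i {e} {e} v) (cleared i e j W) l"
      using assms by (cases rule: pair_index_cases[of l i]) (auto simp: defs)
  qed
  show "cells t (insert (i, j) D) (common (v(i := e))) (insert (2 * i, j) W)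
          = cells t D (planted i {e, j} {e} v) (cleared i e j W)"
  proof (rule ext)
    fix l show "cells t (insert (i, j) D) (common (v(i := e))) (insert (2 * i, j) W) l
          = cells t D (planted i {e, j} {e} v) (cleared i e j W) l"
      using assms by (cases rule: pair_index_cases[of l i]) (auto simp: defs)
  qed
  show "cells t (D - {(i, j)}) (common (v(i := e))) (W - {(2 * i + 1, j)})
          = cells t D (planted i {e} {e} v) (cleared i e j W)"
  proof (rule ext)
    fix l show "cells t (D - {(i, j)}) (common (v(i := e))) (W - {(2 * i + 1, j)}) l
          = cells t D (planted i {e} {e} v) (cleared i e j W) l"
      using assms by (cases rule: pair_index_cases[of l i]) (auto simp: defs)
  qed
  show "cells t (D - {(i, j)}) (common (v(i := e))) (insert (2 * i + 1, j) W)
          = cells t D (planted i {e} {e, j} v) (cleared i e j W)"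
  proof (rule ext)
    fix l show "cells t (D - {(i, j)}) (common (v(i := e))) (insert (2 * i + 1, j) W) l
          = cells t D (planted i {e} {e, j} v) (cleared i e j W) l"
      using assms by (cases rule: pair_index_cases[of l i]) (auto simp: defs)
  qed
qed

definition bits :: "nat \<Rightarrow> nat \<Rightarrow> (nat \<times> nat) set" where
  "bits m t = {..<m} \<times> {..<t}"

lemma finite_bits: "finite (bits m t)"
  by (simp add: bits_def)

definition pairs :: "nat \<Rightarrow> (nat \<times> nat) set" where
  "pairs t = {(e, j). e < t \<and> j < t \<and> e \<noteq> j}"

lemma pairs_subset: "pairs t \<subseteq> {..<t} \<times> {..<t}"
  by (auto simp: pairs_def)

lemma finite_pairs: "finite (pairs t)"
  by (rule finite_subset[OF pairs_subset]) simp

lemma card_pairs: "card (pairs t) = t * (t - 1)"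
proof -
  have "pairs t = (SIGMA e:{..<t}. {..<t} - {e})" by (auto simp: pairs_def)
  then show ?thesis by (simp add: card_SigmaI)
qed

lemma sum_pairs_swap: "(\<Sum>(e, j)\<in>pairs t. f j e) = (\<Sum>(e, j)\<in>pairs t. f e j)"
  by (rule sum.reindex_bij_witness[of _ "\<lambda>(e, j). (j, e)" "\<lambda>(e, j). (j, e)"]) (auto simp: pairs_def)

text \<open>\<open>H b D v\<close> stands for the squared Hellinger influence of the random bit
  \<open>b\<close>, given the selector \<open>D\<close> and the common cells
  \<open>v\<close>.\<close>

context
  fixes H :: "nat \<times> nat \<Rightarrow> (nat \<times> nat) set \<Rightarrow> (nat \<Rightarrow> nat) \<Rightarrow> real" and m t :: nat
  assumes H_nonneg: "H b D v \<ge> 0"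
begin

abbreviation "markers \<equiv> {..<m} \<rightarrow>\<^sub>E {..<t}"

text \<open>These are the squares of the four distances required by
  \<open>hel_intersecting_disjoint\<close>: \<open>j\<close> added to either member when
  \<open>e\<close> is common, and \<open>e\<close> added to either member when \<open>j\<close> is
  common.\<close>

definition defect :: "nat \<Rightarrow> nat \<Rightarrow> nat \<Rightarrow> (nat \<times> nat) set \<Rightarrow> (nat \<Rightarrow> nat) \<Rightarrow> real" where
  "defect i e j D v = H (2 * i, j) (insert (i, j) D) (v(i := e))
      + H (2 * i + 1, j) (D - {(i, j)}) (v(i := e))
      + H (2 * i, e) (insert (i, e) D) (v(i := j))
      + H (2 * i + 1, e) (D - {(i, e)}) (v(i := j))"

text \<open>Changing \<open>D\<close> at one point costs a factor 2, and summing
  \<open>v(i := e)\<close> over all \<open>e\<close> is a resampling, which contributes the factor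
  \<open>t\<close>. The condition \<open>e \<noteq> j\<close> is dropped first, as all terms are
  nonnegative.\<close>

lemma sum_perturbed_le:
  assumes i: "i < m" and F: "F = (\<lambda>j. insert (i, j)) \<or> F = (\<lambda>j D. D - {(i, j)})"
  shows "(\<Sum>(e, j)\<in>pairs t. \<Sum>D\<in>Pow (bits m t). \<Sum>v\<in>markers. H (l, j) (F j D) (v(i := e)))
    \<le> 2 * t * (\<Sum>j<t. \<Sum>D\<in>Pow (bits m t). \<Sum>v\<in>markers. H (l, j) D v)"
proof -
  have "(\<Sum>(e, j)\<in>pairs t. \<Sum>D\<in>Pow (bits m t). \<Sum>v\<in>markers. H (l, j) (F j D) (v(i := e)))
     \<le> (\<Sum>(e, j)\<in>{..<t} \<times> {..<t}. \<Sum>D\<in>Pow (bits m t). \<Sum>v\<in>markers. H (l, j) (F j D) (v(i := e)))"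
    using pairs_subset by (intro sum_mono2) (auto intro!: sum_nonneg H_nonneg)
  also have "\<dots> = (\<Sum>j<t. \<Sum>e<t. \<Sum>D\<in>Pow (bits m t). \<Sum>v\<in>markers. H (l, j) (F j D) (v(i := e)))"
    by (subst sum.cartesian_product[symmetric]) (rule sum.swap)
  also have "\<dots> = (\<Sum>j<t. \<Sum>D\<in>Pow (bits m t). \<Sum>e<t. \<Sum>v\<in>markers. H (l, j) (F j D) (v(i := e)))"
    by (intro sum.cong refl sum.swap)
  also have "\<dots> = (\<Sum>j<t. \<Sum>D\<in>Pow (bits m t). t * (\<Sum>v\<in>markers. H (l, j) (F j D) v))"
    using i by (subst sum_PiE_fun_upd) auto
  also have "\<dots> \<le> (\<Sum>j<t. 2 * (\<Sum>D\<in>Pow (bits m t). t * (\<Sum>v\<in>markers. H (l, j) D v)))"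
  proof (rule sum_mono)
    fix j assume j: "j \<in> {..<t}"
    then have b: "(i, j) \<in> bits m t" using i by (simp add: bits_def)
    have nn: "real t * (\<Sum>v\<in>markers. H (l, j) D v) \<ge> 0" for D
      by (intro mult_nonneg_nonneg sum_nonneg H_nonneg) auto
    show "(\<Sum>D\<in>Pow (bits m t). real t * (\<Sum>v\<in>markers. H (l, j) (F j D) v))
        \<le> 2 * (\<Sum>D\<in>Pow (bits m t). real t * (\<Sum>v\<in>markers. H (l, j) D v))"
      using F sum_Pow_insert_le[OF finite_bits b nn] sum_Pow_remove_le[OF finite_bits b nn] by auto
  qed
  also have "\<dots> = 2 * t * (\<Sum>j<t. \<Sum>D\<in>Pow (bits m t). \<Sum>v\<in>markers. H (l, j) D v)"
    by (simp add: sum_distrib_left mult.assoc)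
  finally show ?thesis .
qed

text \<open>The two halves of \<open>defect\<close> have equal sums by the symmetry of
  \<open>e\<close> and \<open>j\<close>. The indices \<open>2 * i\<close> and
  \<open>2 * i + 1\<close> then run through distinct sets, at most all \<open>m\<close> of
  them.\<close>

lemma sum_defect_le:
  "(\<Sum>i<m div 2. \<Sum>(e, j)\<in>pairs t. \<Sum>D\<in>Pow (bits m t). \<Sum>v\<in>markers. defect i e j D v)
    \<le> 4 * t * (\<Sum>D\<in>Pow (bits m t). \<Sum>v\<in>markers. \<Sum>b\<in>bits m t. H b D v)"
proof -
  let ?S = "\<lambda>l. \<Sum>j<t. \<Sum>D\<in>Pow (bits m t). \<Sum>v\<in>markers. H (l, j) D v"
  have S_nonneg: "?S l \<ge> 0" for l by (intro sum_nonneg H_nonneg)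
  have "(\<Sum>i<m div 2. \<Sum>(e, j)\<in>pairs t. \<Sum>D\<in>Pow (bits m t). \<Sum>v\<in>markers. defect i e j D v)
     \<le> (\<Sum>i<m div 2. 4 * t * (?S (2 * i) + ?S (2 * i + 1)))"
  proof (rule sum_mono)
    fix i assume "i \<in> {..<m div 2}"
    then have i: "i < m" by auto
    define a1 where "a1 e j = (\<Sum>D\<in>Pow (bits m t). \<Sum>v\<in>markers. H (2 * i, j) (insert (i, j) D) (v(i := e)))" for e j
    define a2 where "a2 e j = (\<Sum>D\<in>Pow (bits m t). \<Sum>v\<in>markers. H (2 * i + 1, j) (D - {(i, j)}) (v(i := e)))" for e j
    have "(\<Sum>(e, j)\<in>pairs t. \<Sum>D\<in>Pow (bits m t). \<Sum>v\<in>markers. defect i e j D v)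
        = (\<Sum>(e, j)\<in>pairs t. a1 e j + a2 e j + a1 j e + a2 j e)"
      unfolding defect_def a1_def a2_def sum.distrib by simp
    also have "\<dots> = (\<Sum>(e, j)\<in>pairs t. a1 e j) + (\<Sum>(e, j)\<in>pairs t. a2 e j)
        + (\<Sum>(e, j)\<in>pairs t. a1 j e) + (\<Sum>(e, j)\<in>pairs t. a2 j e)"
      by (simp only: sum.distrib case_prod_unfold)
    also have "\<dots> = 2 * (\<Sum>(e, j)\<in>pairs t. a1 e j) + 2 * (\<Sum>(e, j)\<in>pairs t. a2 e j)"
      using sum_pairs_swap[of a1 t] sum_pairs_swap[of a2 t] by linarith
    also have "\<dots> \<le> 2 * (2 * t * ?S (2 * i)) + 2 * (2 * t * ?S (2 * i + 1))"
      unfolding a1_def a2_def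
      by (intro add_mono mult_left_mono sum_perturbed_le i) auto
    finally show "(\<Sum>(e, j)\<in>pairs t. \<Sum>D\<in>Pow (bits m t). \<Sum>v\<in>markers. defect i e j D v)
        \<le> 4 * t * (?S (2 * i) + ?S (2 * i + 1))" by (simp add: algebra_simps)
  qed
  also have "\<dots> = 4 * t * (\<Sum>i<m div 2. ?S (2 * i) + ?S (2 * i + 1))" by (simp only: sum_distrib_left)
  also have "\<dots> \<le> 4 * t * (\<Sum>l<m. ?S l)"
  proof (rule mult_left_mono)
    have "(\<Sum>i<M. ?S (2 * i) + ?S (2 * i + 1)) = (\<Sum>l<2 * M. ?S l)" for M
      by (induction M) simp_all
    then have "(\<Sum>i<m div 2. ?S (2 * i) + ?S (2 * i + 1)) = (\<Sum>l<2 * (m div 2). ?S l)" .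
    also have "\<dots> \<le> (\<Sum>l<m. ?S l)" using S_nonneg by (intro sum_mono2) auto
    finally show "(\<Sum>i<m div 2. ?S (2 * i) + ?S (2 * i + 1)) \<le> (\<Sum>l<m. ?S l)" .
  qed auto
  also have "(\<Sum>l<m. ?S l) = (\<Sum>b\<in>bits m t. \<Sum>D\<in>Pow (bits m t). \<Sum>v\<in>markers. H b D v)"
  proof -
    have "(\<Sum>l<m. \<Sum>j<t. G (l, j)) = (\<Sum>b\<in>bits m t. G b)" for G :: "nat \<times> nat \<Rightarrow> real"
      by (simp add: sum.cartesian_product bits_def)
    then show ?thesis .
  qed
  also have "\<dots> = (\<Sum>D\<in>Pow (bits m t). \<Sum>v\<in>markers. \<Sum>b\<in>bits m t. H b D v)"
    by (subst sum.swap) (intro sum.cong refl sum.swap)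
  finally show ?thesis .
qed

end

section \<open>Yes and no instances, and the acceptance gap for a fixed seed and order\<close>

lemma cells_cong:
  assumes "F l = F' l" "\<And>k. (l, k) \<in> W \<longleftrightarrow> (l, k) \<in> W'"
  shows "cells t D F W l = cells t D F' W' l"
  using assms by (simp add: cells_def)

text \<open>One sample drives a yes and a no instance that differ only in the odd member of pair
  \<open>i\<close>, so the two can be compared term by term.\<close>

definition yes_cells :: "nat \<Rightarrow> nat \<times> (nat \<times> nat) \<times> (nat \<times> nat) set \<times> (nat \<Rightarrow> nat) \<times> (nat \<times> nat) set
    \<Rightarrow> nat \<Rightarrow> nat set" where
  "yes_cells t = (\<lambda>(i, (e, j), D, v, W). cells t D (planted i {e} {j} v) (cleared i e j W))"

definition no_cells :: "nat \<Rightarrow> nat \<times> (nat \<times> nat) \<times> (nat \<times> nat) set \<times> (nat \<Rightarrow> nat) \<times> (nat \<times> nat) set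
    \<Rightarrow> nat \<Rightarrow> nat set" where
  "no_cells t = (\<lambda>(i, (e, j), D, v, W). cells t D (planted i {e} {e} v) (cleared i e j W))"

definition samples ::
  "nat \<Rightarrow> nat \<Rightarrow> (nat \<times> (nat \<times> nat) \<times> (nat \<times> nat) set \<times> (nat \<Rightarrow> nat) \<times> (nat \<times> nat) set) set" where
  "samples m t = {..<m div 2} \<times> pairs t \<times> Pow (bits m t) \<times> ({..<m} \<rightarrow>\<^sub>E {..<t}) \<times> Pow (bits m t)"

lemma finite_samples: "finite (samples m t)"
  by (simp add: samples_def finite_pairs finite_bits finite_PiE)

text \<open>Seed, labelling and order are fixed here; only the sample varies.
  \<open>\<theta>\<close> is the output threshold that separates small from large optima, later
  \<open>2 * \<alpha>\<close>.\<close>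

locale streamed =
  fixes A :: stream_alg and r m p s t n :: nat and g :: "nat \<Rightarrow> nat \<Rightarrow> nat" and \<pi> :: "nat \<Rightarrow> nat"
    and \<theta> :: real
  assumes space: "uses_space A s" and perm: "\<pi> permutes {..<m}" and m_pos: "m > 0" and p_pos: "p \<ge> 1"
begin

definition run :: "(nat \<Rightarrow> nat set) \<Rightarrow> nat \<Rightarrow> nat" where
  "run C = transcript A r m p (\<lambda>q. cutset n g C (\<pi> q))"

definition accepts :: "(nat \<Rightarrow> nat set) \<Rightarrow> bool" where
  "accepts C \<longleftrightarrow> alg_output A r p (random_order (map (cutset n g C) [0..<m]) \<pi>) \<le> \<theta>"

lemma accepts_run: "accepts C \<longleftrightarrow> alg_out A r (run C (p * m)) \<le> \<theta>"
proof -
  have "\<pi> q < m" if "q < m" for q using perm that permutes_in_image[OF perm, of q] by simp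
  then have "random_order (map (cutset n g C) [0..<m]) \<pi> = map (\<lambda>q. cutset n g C (\<pi> q)) [0..<m]"
    by (simp add: random_order_def)
  then show ?thesis
    by (simp add: accepts_def run_def alg_output_state_at transcript_final m_pos)
qed

abbreviation "B \<equiv> bits m t"
abbreviation "Q \<equiv> transcripts m p s"

definition base :: "(nat \<times> nat) set \<Rightarrow> (nat \<Rightarrow> nat) \<Rightarrow> (nat \<times> nat) set \<Rightarrow> nat \<Rightarrow> nat" where
  "base D v W = run (cells t D (common v) W)"

definition Tr :: "nat \<Rightarrow> nat \<Rightarrow> nat \<Rightarrow> (nat \<times> nat) set \<Rightarrow> (nat \<Rightarrow> nat) \<Rightarrow> nat set \<Rightarrow> nat set
    \<Rightarrow> (nat \<times> nat) set \<Rightarrow> nat \<Rightarrow> nat" where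
  "Tr i e j D v x y W = run (cells t D (planted i x y v) (cleared i e j W))"

definition H :: "nat \<times> nat \<Rightarrow> (nat \<times> nat) set \<Rightarrow> (nat \<Rightarrow> nat) \<Rightarrow> real" where
  "H b D v = (hel B Q (\<lambda>W. base D v (W - {b})) (\<lambda>W. base D v (insert b W)))\<^sup>2"

lemma run_in: "run C \<in> Q"
  unfolding run_def by (rule transcript_in[OF space])

lemma sum_H_le: "(\<Sum>b\<in>B. H b D v) \<le> 8 * ln (card Q)"
  unfolding H_def
  by (rule sum_hel_sq_le) (auto simp: finite_bits finite_transcripts base_def run_in)

text \<open>\<open>inv \<pi> l\<close> is the stream position of set \<open>l\<close>. An unsplit
  pair has both members in one block, where there are no two separate players.\<close>

definition unsplit :: "nat \<Rightarrow> bool" where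
  "unsplit i \<longleftrightarrow> block m (inv \<pi> (2 * i)) = block m (inv \<pi> (2 * i + 1))"

text \<open>The first player owns the block that contains set \<open>2 * i\<close>. For a split pair
  \<open>x\<close> is read only inside this block and \<open>y\<close> only outside it, so
  \<open>transcript_mix\<close> applies.\<close>

lemma rectangle:
  assumes "\<not> unsplit i"
  shows "rectangle_property B {(l, k). block m (inv \<pi> l) = block m (inv \<pi> (2 * i))} Q (Tr i e j D v)"
    (is "rectangle_property B ?B1 Q _")
proof
  show "finite B" "finite Q" by (simp_all add: finite_bits finite_transcripts)
  show "Tr i e j D v x y \<in> Pow B \<rightarrow> Q" for x y by (simp add: Tr_def run_in)
  fix W W' x y x' y'
  assume eq: "Tr i e j D v x y W = Tr i e j D v x' y' W'"
  let ?u = "block m (inv \<pi> (2 * i))"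
  have inv: "inv \<pi> (\<pi> q) = q" for q using perm by (simp add: permutes_inverses)
  show "Tr i e j D v x y' ((W \<inter> ?B1) \<union> (W' - ?B1)) = Tr i e j D v x y W"
    unfolding Tr_def run_def
  proof (rule transcript_mix[where u = ?u])
    show "transcript A r m p (\<lambda>q. cutset n g (cells t D (planted i x y v) (cleared i e j W)) (\<pi> q))
        = transcript A r m p (\<lambda>q. cutset n g (cells t D (planted i x' y' v) (cleared i e j W')) (\<pi> q))"
      using eq by (simp add: Tr_def run_def)
    fix q
    show "cutset n g (cells t D (planted i x y' v) (cleared i e j (W \<inter> ?B1 \<union> (W' - ?B1)))) (\<pi> q)
        = cutset n g (cells t D (planted i x y v) (cleared i e j W)) (\<pi> q)" if "block m q = ?u"
    proof -
      have "\<pi> q \<noteq> 2 * i + 1" using assms that inv[of q] by (auto simp: unsplit_def)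
      then have "cells t D (planted i x y' v) (cleared i e j (W \<inter> ?B1 \<union> (W' - ?B1))) (\<pi> q)
          = cells t D (planted i x y v) (cleared i e j W) (\<pi> q)"
        using that by (intro cells_cong) (auto simp: planted_def cleared_def inv)
      then show ?thesis by (simp add: cutset_def)
    qed
    show "cutset n g (cells t D (planted i x y' v) (cleared i e j (W \<inter> ?B1 \<union> (W' - ?B1)))) (\<pi> q)
        = cutset n g (cells t D (planted i x' y' v) (cleared i e j W')) (\<pi> q)" if "block m q \<noteq> ?u"
    proof -
      have "\<pi> q \<noteq> 2 * i" using that inv[of q] by auto
      then have "cells t D (planted i x y' v) (cleared i e j (W \<inter> ?B1 \<union> (W' - ?B1))) (\<pi> q)
          = cells t D (planted i x' y' v) (cleared i e j W') (\<pi> q)"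
        using that by (intro cells_cong) (auto simp: planted_def cleared_def inv)
      then show ?thesis by (simp add: cutset_def)
    qed
  qed
qed

lemma H_nonneg: "H b D v \<ge> 0"
  by (simp add: H_def)

lemma H_perturbed:
  assumes "e \<noteq> j" "e < t" "j < t"
  shows "H (2 * i, j) (insert (i, j) D) (v(i := e))
          = (hel B Q (Tr i e j D v {e} {e}) (Tr i e j D v {e, j} {e}))\<^sup>2"
    and "H (2 * i + 1, j) (D - {(i, j)}) (v(i := e))
          = (hel B Q (Tr i e j D v {e} {e}) (Tr i e j D v {e} {e, j}))\<^sup>2"
proof -
  show "H (2 * i, j) (insert (i, j) D) (v(i := e))
          = (hel B Q (Tr i e j D v {e} {e}) (Tr i e j D v {e, j} {e}))\<^sup>2"
    unfolding H_def base_def cells_planted(1,2)[OF assms] Tr_def by (rule refl)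
  show "H (2 * i + 1, j) (D - {(i, j)}) (v(i := e))
          = (hel B Q (Tr i e j D v {e} {e}) (Tr i e j D v {e} {e, j}))\<^sup>2"
    unfolding H_def base_def cells_planted(3,4)[OF assms] Tr_def by (rule refl)
qed

lemma Tr_swap: "Tr i j e D v = Tr i e j D v"
proof -
  have "cleared i j e W = cleared i e j W" for W by (auto simp: cleared_def)
  then show ?thesis by (simp add: Tr_def fun_eq_iff)
qed

text \<open>The square of each of the four distances is a summand of \<open>defect\<close>, and the
  other summands are nonnegative.\<close>

lemma hel_Tr_le:
  assumes "\<not> unsplit i" "(e, j) \<in> pairs t"
  shows "hel B Q (Tr i e j D v {e} {e}) (Tr i e j D v {e} {j}) \<le> 8 * sqrt (defect H i e j D v)"
proof -
  interpret rectangle_property B "{(l, k). block m (inv \<pi> l) = block m (inv \<pi> (2 * i))}" Q "Tr i e j D v"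
    by (rule rectangle[OF assms(1)])
  have ej: "e \<noteq> j" "e < t" "j < t" using assms(2) by (auto simp: pairs_def)
  have ji: "j \<noteq> e" "j < t" "e < t" using ej by auto
  have d: "defect H i e j D v =
     (hel B Q (Tr i e j D v {e} {e}) (Tr i e j D v {e, j} {e}))\<^sup>2 +
     (hel B Q (Tr i e j D v {e} {e}) (Tr i e j D v {e} {e, j}))\<^sup>2 +
     (hel B Q (Tr i e j D v {j} {j}) (Tr i e j D v {e, j} {j}))\<^sup>2 +
     (hel B Q (Tr i e j D v {j} {j}) (Tr i e j D v {j} {e, j}))\<^sup>2"
    unfolding defect_def[OF H_nonneg] H_perturbed[OF ej] H_perturbed[OF ji] Tr_swap[of i j e]
    by (simp add: insert_commute)
  show ?thesis
    by (rule hel_intersecting_disjoint[where c = "{e, j}"]; rule real_le_rsqrt; simp add: d)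
qed

definition accept_fraction :: "((nat \<times> nat) set \<Rightarrow> nat \<Rightarrow> nat) \<Rightarrow> real" where
  "accept_fraction f = card {W \<in> Pow B. alg_out A r (f W (p * m)) \<le> \<theta>} / 2 ^ card B"

lemma accept_fraction_law:
  assumes "f \<in> Pow B \<rightarrow> Q"
  shows "accept_fraction f = (\<Sum>\<tau>\<in>{\<tau> \<in> Q. alg_out A r (\<tau> (p * m)) \<le> \<theta>}. law B f \<tau>)"
proof -
  have "{W \<in> Pow B. f W \<in> {\<tau> \<in> Q. alg_out A r (\<tau> (p * m)) \<le> \<theta>}}
      = {W \<in> Pow B. alg_out A r (f W (p * m)) \<le> \<theta>}"
    using assms by auto
  then show ?thesis
    unfolding accept_fraction_def by (subst sum_law) (simp_all add: finite_bits finite_transcripts)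
qed

lemma accept_fraction_bounds: "0 \<le> accept_fraction f" "accept_fraction f \<le> 1"
proof -
  have "card {W \<in> Pow B. alg_out A r (f W (p * m)) \<le> \<theta>} \<le> card (Pow B)"
    by (rule card_mono) (auto simp: finite_bits)
  then have "real (card {W \<in> Pow B. alg_out A r (f W (p * m)) \<le> \<theta>}) \<le> real (card (Pow B))"
    by (simp only: of_nat_le_iff)
  then have "real (card {W \<in> Pow B. alg_out A r (f W (p * m)) \<le> \<theta>}) \<le> 2 ^ card B"
    by (simp add: card_Pow finite_bits)
  then show "accept_fraction f \<le> 1" unfolding accept_fraction_def by simp
qed (simp add: accept_fraction_def)

text \<open>An unsplit pair gets the trivial bound 1. For a split pair the bound through the square
  root of \<open>defect\<close> is made linear, so that it can be summed, at the price of an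
  additive 1/16.\<close>

lemma accept_gap_le:
  assumes "(e, j) \<in> pairs t"
  shows "accept_fraction (Tr i e j D v {e} {j}) - accept_fraction (Tr i e j D v {e} {e})
       \<le> of_bool (unsplit i) + 1/16 + 1024 * defect H i e j D v"
proof -
  have nn: "defect H i e j D v \<ge> 0"
    unfolding defect_def[OF H_nonneg] by (intro add_nonneg_nonneg H_nonneg)
  show ?thesis
  proof (cases "unsplit i")
    case True
    then show ?thesis
      using nn accept_fraction_bounds[of "Tr i e j D v {e} {j}"]
        accept_fraction_bounds[of "Tr i e j D v {e} {e}"] by simp
  next
    case False
    let ?d = "sqrt (defect H i e j D v)"
    have in_Q: "Tr i e j D v x y \<in> Pow B \<rightarrow> Q" for x y by (simp add: Tr_def run_in)
    have "accept_fraction (Tr i e j D v {e} {j}) - accept_fraction (Tr i e j D v {e} {e})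
        \<le> 2 * hel B Q (Tr i e j D v {e} {j}) (Tr i e j D v {e} {e})"
      unfolding accept_fraction_law[OF in_Q]
      by (rule sum_law_diff_le) (auto simp: finite_bits finite_transcripts Tr_def run_in)
    also have "\<dots> \<le> 16 * ?d"
      using hel_Tr_le[OF False assms, of D v] by (simp add: hel_commute)
    \<comment> \<open>This is the expansion of \<open>(1/4 - 32 * d) ^ 2 \<ge> 0\<close> for the
      square root \<open>d\<close> of the defect.\<close>
    also have "\<dots> \<le> 1/16 + 1024 * ?d\<^sup>2"
      using zero_le_power2[of "1/4 - 32 * ?d"] by (simp add: power2_eq_square algebra_simps)
    also have "?d\<^sup>2 = defect H i e j D v" using nn by simp
    finally show ?thesis using False by simp
  qed
qed

lemma sum_accept_gap_le:
  "(\<Sum>\<xi>\<in>samples m t. of_bool (accepts (yes_cells t \<xi>)) - of_bool (accepts (no_cells t \<xi>)))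
    \<le> 2 ^ card B * (\<Sum>i<m div 2. card (pairs t) * (2 ^ card B * card ({..<m} \<rightarrow>\<^sub>E {..<t})) * (of_bool (unsplit i) + 1/16))
      + 2 ^ card B * (2 ^ card B * card ({..<m} \<rightarrow>\<^sub>E {..<t}) * (32768 * t * ln (card Q)))"
proof -
  let ?E = "{..<m} \<rightarrow>\<^sub>E {..<t}" and ?K = "2 ^ card B :: real"
  have fr: "(\<Sum>W\<in>Pow B. of_bool (accepts (cells t D (planted i x y v) (cleared i e j W))))
      = ?K * accept_fraction (Tr i e j D v x y)" for i e j D v x y
  proof -
    have "(\<Sum>W\<in>Pow B. of_bool (accepts (cells t D (planted i x y v) (cleared i e j W))))
        = real (card (Pow B \<inter> {W. accepts (cells t D (planted i x y v) (cleared i e j W))}))"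
      by (simp add: finite_bits)
    also have "Pow B \<inter> {W. accepts (cells t D (planted i x y v) (cleared i e j W))}
        = {W \<in> Pow B. alg_out A r (Tr i e j D v x y W (p * m)) \<le> \<theta>}"
      by (auto simp: accepts_run Tr_def)
    finally show ?thesis by (simp add: accept_fraction_def)
  qed
  have "(\<Sum>\<xi>\<in>samples m t. of_bool (accepts (yes_cells t \<xi>)) - of_bool (accepts (no_cells t \<xi>)))
      = (\<Sum>i<m div 2. \<Sum>(e, j)\<in>pairs t. \<Sum>D\<in>Pow B. \<Sum>v\<in>?E. \<Sum>W\<in>Pow B.
          of_bool (accepts (cells t D (planted i {e} {j} v) (cleared i e j W)))
          - of_bool (accepts (cells t D (planted i {e} {e} v) (cleared i e j W))) :: real)"
    unfolding samples_def yes_cells_def no_cells_def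
    by (simp add: sum.cartesian_product case_prod_unfold)
  also have "\<dots> = (\<Sum>i<m div 2. \<Sum>(e, j)\<in>pairs t. \<Sum>D\<in>Pow B. \<Sum>v\<in>?E.
      ?K * (accept_fraction (Tr i e j D v {e} {j}) - accept_fraction (Tr i e j D v {e} {e})))"
    by (simp only: right_diff_distrib fr[symmetric] sum_subtractf)
  also have "\<dots> \<le> (\<Sum>i<m div 2. \<Sum>(e, j)\<in>pairs t. \<Sum>D\<in>Pow B. \<Sum>v\<in>?E.
      ?K * ((of_bool (unsplit i) + 1/16) + 1024 * defect H i e j D v))"
  proof (intro sum_mono)
    fix i a
    assume "a \<in> pairs t"
    then show "(case a of (e, j) \<Rightarrow> \<Sum>D\<in>Pow B. \<Sum>v\<in>?E.
        ?K * (accept_fraction (Tr i e j D v {e} {j}) - accept_fraction (Tr i e j D v {e} {e})))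
      \<le> (case a of (e, j) \<Rightarrow> \<Sum>D\<in>Pow B. \<Sum>v\<in>?E.
        ?K * ((of_bool (unsplit i) + 1/16) + 1024 * defect H i e j D v))"
      by (cases a) (simp only: prod.case, intro sum_mono mult_left_mono accept_gap_le, simp_all)
  qed
  also have "\<dots> = (\<Sum>i<m div 2. \<Sum>(e, j)\<in>pairs t. \<Sum>D\<in>Pow B. \<Sum>v\<in>?E. ?K * (of_bool (unsplit i) + 1/16))
     + (\<Sum>i<m div 2. \<Sum>(e, j)\<in>pairs t. \<Sum>D\<in>Pow B. \<Sum>v\<in>?E. ?K * (1024 * defect H i e j D v))"
    by (simp only: distrib_left sum.distrib case_prod_unfold)
  also have "(\<Sum>i<m div 2. \<Sum>(e, j)\<in>pairs t. \<Sum>D\<in>Pow B. \<Sum>v\<in>?E. ?K * (of_bool (unsplit i) + 1/16))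
     = ?K * (\<Sum>i<m div 2. card (pairs t) * (?K * card ?E) * (of_bool (unsplit i) + 1/16))"
    by (simp add: sum_distrib_left card_Pow finite_bits mult_ac)
  also have "(\<Sum>i<m div 2. \<Sum>(e, j)\<in>pairs t. \<Sum>D\<in>Pow B. \<Sum>v\<in>?E. ?K * (1024 * defect H i e j D v))
     = ?K * 1024 * (\<Sum>i<m div 2. \<Sum>(e, j)\<in>pairs t. \<Sum>D\<in>Pow B. \<Sum>v\<in>?E. defect H i e j D v)"
    by (simp add: sum_distrib_left case_prod_unfold mult.assoc)
  also have "\<dots> \<le> ?K * 1024 * (4 * t * (\<Sum>D\<in>Pow B. \<Sum>v\<in>?E. \<Sum>b\<in>B. H b D v))"
    by (intro mult_left_mono sum_defect_le H_nonneg) auto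
  also have "\<dots> \<le> ?K * 1024 * (4 * t * (\<Sum>D\<in>Pow B. \<Sum>v\<in>?E. 8 * ln (card Q)))"
    by (intro mult_left_mono sum_mono sum_H_le) auto
  \<comment> \<open>The constant is \<open>1024 * 4 * 8\<close>.\<close>
  also have "\<dots> = ?K * (?K * card ?E * (32768 * t * ln (card Q)))"
    by (simp add: card_Pow finite_bits)
  finally show ?thesis by simp
qed

end

subsection \<open>Random order\<close>

lemma card_same_block_le: "card {q. q < m \<and> block m q = c} \<le> m div 4 + 1"
proof -
  define h where "h = m div 4 + 1"
  have "h > 0" by (simp add: h_def)
  have "{q. q < m \<and> block m q = c} \<subseteq> {c * h..<c * h + h}"
  proof
    fix q assume "q \<in> {q. q < m \<and> block m q = c}"
    then have "q div h = c" by (simp add: block_def h_def)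
    then have "q = c * h + q mod h" by (metis div_mult_mod_eq)
    moreover have "q mod h < h" using \<open>h > 0\<close> by simp
    ultimately show "q \<in> {c * h..<c * h + h}" by (metis atLeastLessThan_iff le_add1 nat_add_left_cancel_less)
  qed
  then have "card {q. q < m \<and> block m q = c} \<le> card {c * h..<c * h + h}"
    by (rule card_mono[rotated]) simp
  then show ?thesis by (simp add: h_def)
qed

text \<open>By symmetry the probability that \<open>a\<close> and \<open>b\<close> land in the same block does not depend on
  \<open>b \<noteq> a\<close>, so it may be averaged over \<open>b\<close>.\<close>

lemma same_block_permutations_le:
  assumes "m \<ge> 4" "a < m" "b < m" "a \<noteq> b"
  shows "(\<Sum>\<pi>\<in>{\<pi>. \<pi> permutes {..<m}}. of_bool (block m (inv \<pi> a) = block m (inv \<pi> b)))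
     \<le> (fact m / 3 :: real)"
proof -
  let ?P = "{\<pi>. \<pi> permutes {..<m}}"
  define f where "f c = (\<Sum>\<pi>\<in>?P. of_bool (block m (\<pi> a) = block m (\<pi> c)) :: real)" for c
  have finP: "finite ?P" by (simp add: finite_permutations)
  have cardP: "card ?P = fact m" by (simp add: card_permutations)
  have f_eq: "f c = f b" if "c < m" "c \<noteq> a" for c
  proof -
    have "Transposition.transpose b c permutes {..<m}" using assms that by (intro permutes_swap_id) auto
    from sum_permutations_compose_right[OF this, of "\<lambda>\<pi>. of_bool (block m (\<pi> a) = block m (\<pi> c))"]
    have "f c = (\<Sum>\<pi>\<in>?P. of_bool (block m ((\<pi> \<circ> Transposition.transpose b c) a)
        = block m ((\<pi> \<circ> Transposition.transpose b c) c)))"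
      by (simp only: f_def)
    moreover have "Transposition.transpose b c a = a" "Transposition.transpose b c c = b"
      using that assms by (simp_all add: Transposition.transpose_def)
    ultimately show ?thesis by (simp only: f_def comp_apply)
  qed
  have "(real m - 1) * f b = (\<Sum>c\<in>{..<m} - {a}. f c)"
  proof -
    have "(\<Sum>c\<in>{..<m} - {a}. f c) = (\<Sum>c\<in>{..<m} - {a}. f b)" by (rule sum.cong[OF refl], rule f_eq) auto
    then show ?thesis using assms by (simp add: of_nat_diff)
  qed
  also have "\<dots> = (\<Sum>\<pi>\<in>?P. \<Sum>c\<in>{..<m} - {a}. of_bool (block m (\<pi> a) = block m (\<pi> c)))"
    unfolding f_def by (rule sum.swap)
  also have "\<dots> \<le> (\<Sum>\<pi>\<in>?P. real m / 4)"
  proof (rule sum_mono)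
    fix \<pi> assume "\<pi> \<in> ?P"
    then have perm: "\<pi> permutes {..<m}" by simp
    let ?S = "{c \<in> {..<m} - {a}. block m (\<pi> a) = block m (\<pi> c)}"
    \<comment> \<open>The value at \<open>a\<close> takes up one of the at most
      \<open>m div 4 + 1\<close> places of its block, which leaves \<open>m div 4\<close> for the
      others.\<close>
    have "insert (\<pi> a) (\<pi> ` ?S) \<subseteq> {q. q < m \<and> block m q = block m (\<pi> a)}"
    proof -
      have "\<pi> q < m" if "q < m" for q using permutes_in_image[OF perm, of q] that by simp
      moreover have "block m (\<pi> c) = block m (\<pi> a)" if "c \<in> ?S" for c using that by simp
      ultimately show ?thesis using assms(2) by blast
    qed
    then have "card (insert (\<pi> a) (\<pi> ` ?S)) \<le> card {q. q < m \<and> block m q = block m (\<pi> a)}"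
      by (rule card_mono[rotated]) simp
    also have "\<dots> \<le> m div 4 + 1" by (rule card_same_block_le)
    finally have "card (insert (\<pi> a) (\<pi> ` ?S)) \<le> m div 4 + 1" .
    moreover have "\<pi> a \<notin> \<pi> ` ?S" using permutes_inj[OF perm] by (auto dest: injD)
    ultimately have "card (\<pi> ` ?S) \<le> m div 4" by simp
    moreover have "card (\<pi> ` ?S) = card ?S"
      using permutes_inj[OF perm] by (intro card_image) (auto intro: inj_on_subset)
    ultimately have "card ?S \<le> m div 4" by simp
    moreover have "(\<Sum>c\<in>{..<m} - {a}. of_bool (block m (\<pi> a) = block m (\<pi> c))) = real (card ?S)"
      by (subst sum_of_bool_eq) (auto intro!: arg_cong[of _ _ card])
    ultimately show "(\<Sum>c\<in>{..<m} - {a}. of_bool (block m (\<pi> a) = block m (\<pi> c))) \<le> real m / 4"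
      by linarith
  qed
  also have "\<dots> = fact m * (real m / 4)" by (simp add: cardP)
  finally have "(real m - 1) * f b \<le> fact m * (real m / 4)" .
  \<comment> \<open>\<open>m / 4 \<le> (m - 1) / 3\<close> is where \<open>m \<ge> 4\<close>
    enters.\<close>
  also have "\<dots> \<le> fact m * ((real m - 1) / 3)" using assms by (intro mult_left_mono) auto
  also have "\<dots> = (real m - 1) * (fact m / 3)" by simp
  finally have "f b \<le> fact m / 3" using assms by (subst (asm) mult_le_cancel_left_pos) auto
  then show ?thesis
    using sum_permutations_inverse[of "\<lambda>\<pi>. of_bool (block m (\<pi> a) = block m (\<pi> b)) :: real" "{..<m}"]
    by (simp only: f_def)
qed

subsection \<open>Random labellings of the universe\<close>

definition labellings :: "nat \<Rightarrow> nat \<Rightarrow> nat \<Rightarrow> (nat \<Rightarrow> nat \<Rightarrow> nat) set" where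
  "labellings n m t = {1..n} \<rightarrow>\<^sub>E ({..<m} \<rightarrow>\<^sub>E {..<3 * t})"

lemma finite_labellings: "finite (labellings n m t)"
  by (simp add: labellings_def finite_PiE)

text \<open>The two ways in which a labelling can spoil a no instance: an element lies in no set, or
  some \<open>k\<close> sets already cover everything.\<close>

definition degenerate :: "nat \<Rightarrow> nat \<Rightarrow> nat \<Rightarrow> (nat \<Rightarrow> nat set) \<Rightarrow> (nat \<Rightarrow> nat \<Rightarrow> nat) \<Rightarrow> bool" where
  "degenerate n m k C g \<longleftrightarrow>
     (\<exists>x\<in>{1..n}. \<forall>l<m. g x (l div 2) \<in> C l) \<or>
     (\<exists>I\<subseteq>{..<m}. card I \<le> k \<and> (\<forall>x\<in>{1..n}. \<exists>l\<in>I. g x (l div 2) \<notin> C l))"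

lemma is_cover_cutset:
  "is_cover n (map (cutset n g C) [0..<m]) I \<longleftrightarrow>
     I \<subseteq> {..<m} \<and> (\<forall>x\<in>{1..n}. \<exists>l\<in>I. g x (l div 2) \<notin> C l)"
proof -
  have "(\<Union>l\<in>I. map (cutset n g C) [0..<m] ! l) = (\<Union>l\<in>I. cutset n g C l)" if "I \<subseteq> {..<m}"
    using that by (intro SUP_cong) auto
  then show ?thesis unfolding is_cover_def cutset_def by auto
qed

lemma is_instance_cutset:
  assumes "I \<subseteq> {..<m}" "\<forall>x\<in>{1..n}. \<exists>l\<in>I. g x (l div 2) \<notin> C l"
  shows "is_instance n m (map (cutset n g C) [0..<m])"
  using assms by (fastforce simp: is_instance_def cutset_def)

lemma finite_covers: "finite {I. is_cover n S I}"
  by (rule finite_subset[of _ "Pow {..<length S}"]) (auto simp: is_cover_def)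

lemma set_cover_opt_le: "is_cover n S I \<Longrightarrow> set_cover_opt n S \<le> card I"
  unfolding set_cover_opt_def by (intro Min_le) (auto simp: finite_covers)

lemma not_degenerate:
  assumes "\<not> degenerate n m k C g"
  shows "is_instance n m (map (cutset n g C) [0..<m])"
    and "set_cover_opt n (map (cutset n g C) [0..<m]) > k"
proof -
  let ?S = "map (cutset n g C) [0..<m]"
  have all: "\<forall>x\<in>{1..n}. \<exists>l\<in>{..<m}. g x (l div 2) \<notin> C l"
    using assms unfolding degenerate_def by (meson lessThan_iff)
  then show "is_instance n m ?S" by (intro is_instance_cutset[of "{..<m}"]) auto
  have "is_cover n ?S {..<m}" using all by (simp add: is_cover_cutset)
  then have "card ` {I. is_cover n ?S I} \<noteq> {}" by blast
  then have "set_cover_opt n ?S \<in> card ` {I. is_cover n ?S I}"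
    unfolding set_cover_opt_def by (intro Min_in) (auto simp: finite_covers)
  then obtain I where I: "is_cover n ?S I" "set_cover_opt n ?S = card I" by auto
  then show "set_cover_opt n ?S > k"
    using assms unfolding degenerate_def is_cover_cutset by (metis not_le)
qed

text \<open>\<open>D\<close> assigns every random cell to one member only, and the filler ranges
  \<open>{t..<2 * t}\<close> and \<open>{2 * t..<3 * t}\<close> are disjoint. The members of a pair
  can therefore meet only in forced cells.\<close>

lemma cells_pair_Int:
  assumes "2 * i + 1 < m" "i' < m div 2" "e < t" "j < t" "v \<in> {..<m} \<rightarrow>\<^sub>E {..<t}"
  shows "no_cells t (i', (e, j), D, v, W) (2 * i) \<inter> no_cells t (i', (e, j), D, v, W) (2 * i + 1)
          = {if i = i' then e else v i}"
    and "e \<noteq> j \<Longrightarrow>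
          yes_cells t (i', (e, j), D, v, W) (2 * i') \<inter> yes_cells t (i', (e, j), D, v, W) (2 * i' + 1) = {}"
proof -
  have "v i < t" using PiE_mem[OF assms(5), of i] assms(1) by simp
  then show "no_cells t (i', (e, j), D, v, W) (2 * i) \<inter> no_cells t (i', (e, j), D, v, W) (2 * i + 1)
          = {if i = i' then e else v i}"
    using assms(3,4) by (cases "i = i'") (auto simp: no_cells_def cells_def planted_def common_def)
  show "e \<noteq> j \<Longrightarrow>
          yes_cells t (i', (e, j), D, v, W) (2 * i') \<inter> yes_cells t (i', (e, j), D, v, W) (2 * i' + 1) = {}"
    using assms(3,4) by (auto simp: yes_cells_def cells_def planted_def cleared_def)
qed

lemma yes_instance:
  assumes "\<xi> \<in> samples m t"
  shows "is_instance n m (map (cutset n g (yes_cells t \<xi>)) [0..<m])"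
    and "set_cover_opt n (map (cutset n g (yes_cells t \<xi>)) [0..<m]) \<le> 2"
proof -
  obtain i e j D v W where \<xi>: "\<xi> = (i, (e, j), D, v, W)" by (metis prod.exhaust)
  have i: "i < m div 2" and ej: "e < t" "j < t" "e \<noteq> j" and v: "v \<in> {..<m} \<rightarrow>\<^sub>E {..<t}"
    using assms by (auto simp: samples_def \<xi> pairs_def)
  have im: "2 * i + 1 < m" using i by linarith
  let ?I = "{2 * i, 2 * i + 1}"
  have disj: "yes_cells t \<xi> (2 * i) \<inter> yes_cells t \<xi> (2 * i + 1) = {}"
    unfolding \<xi> using cells_pair_Int(2)[OF im i ej(1,2) v ej(3)] .
  have cov: "\<forall>x\<in>{1..n}. \<exists>l\<in>?I. g x (l div 2) \<notin> yes_cells t \<xi> l"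
  proof
    fix x
    have "g x i \<notin> yes_cells t \<xi> (2 * i) \<or> g x i \<notin> yes_cells t \<xi> (2 * i + 1)" using disj by blast
    then show "\<exists>l\<in>?I. g x (l div 2) \<notin> yes_cells t \<xi> l" by auto
  qed
  have sub: "?I \<subseteq> {..<m}" using im by auto
  show "is_instance n m (map (cutset n g (yes_cells t \<xi>)) [0..<m])"
    by (rule is_instance_cutset[OF sub cov])
  have "is_cover n (map (cutset n g (yes_cells t \<xi>)) [0..<m]) ?I"
    using sub cov by (simp only: is_cover_cutset)
  then show "set_cover_opt n (map (cutset n g (yes_cells t \<xi>)) [0..<m]) \<le> 2"
    using set_cover_opt_le by fastforce
qed

text \<open>These are the properties of no instances on which the counting of labellings
  rests.\<close>

lemma no_cells_props:
  assumes "\<xi> \<in> samples m t"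
  shows "l < m \<Longrightarrow> no_cells t \<xi> l \<subseteq> {..<3 * t}"
    and "l < m \<Longrightarrow> card (no_cells t \<xi> l) \<ge> t"
    and "2 * i + 1 < m \<Longrightarrow> \<exists>c. no_cells t \<xi> (2 * i) \<inter> no_cells t \<xi> (2 * i + 1) = {c}"
proof -
  obtain i' e j D v W where \<xi>: "\<xi> = (i', (e, j), D, v, W)" by (metis prod.exhaust)
  have i: "i' < m div 2" and ej: "e < t" "j < t" and v: "v \<in> {..<m} \<rightarrow>\<^sub>E {..<t}"
    using assms by (auto simp: samples_def \<xi> pairs_def)
  show sub: "no_cells t \<xi> l \<subseteq> {..<3 * t}" if "l < m" for l
  proof -
    have "v (l div 2) < t" using PiE_mem[OF v, of "l div 2"] that by auto
    then show ?thesis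
      using ej by (auto simp: no_cells_def \<xi> cells_def planted_def common_def split: if_splits)
  qed
  show "card (no_cells t \<xi> l) \<ge> t" if "l < m"
  proof -
    have "card (if even l then {t..<2 * t} else {2 * t..<3 * t}) \<le> card (no_cells t \<xi> l)"
      using sub[OF that] by (intro card_mono) (auto simp: no_cells_def \<xi> cells_def intro: finite_subset)
    then show ?thesis by (simp split: if_splits)
  qed
  show "\<exists>c. no_cells t \<xi> (2 * i) \<inter> no_cells t \<xi> (2 * i + 1) = {c}" if "2 * i + 1 < m"
    unfolding \<xi> using cells_pair_Int(1)[OF that i ej v] by blast
qed

section \<open>Counting degenerate labellings\<close>

lemma card_PiE_constrained:
  assumes "finite I" "x \<in> I" "U \<subseteq> X" "finite X"
  shows "card {g \<in> I \<rightarrow>\<^sub>E X. g x \<in> U} * card X = card U * card (I \<rightarrow>\<^sub>E X)"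
proof -
  have "{g \<in> I \<rightarrow>\<^sub>E X. g x \<in> U} = PiE I (\<lambda>y. if y = x then U else X)"
  proof (intro equalityI subsetI)
    fix g assume "g \<in> {g \<in> I \<rightarrow>\<^sub>E X. g x \<in> U}"
    then show "g \<in> PiE I (\<lambda>y. if y = x then U else X)" by (simp add: PiE_iff)
  next
    fix g assume g: "g \<in> PiE I (\<lambda>y. if y = x then U else X)"
    then have "g x \<in> U" using PiE_mem[OF g assms(2)] by simp
    moreover have "g y \<in> X" if "y \<in> I" for y
      using PiE_mem[OF g that] assms(3) by (auto split: if_splits)
    ultimately show "g \<in> {g \<in> I \<rightarrow>\<^sub>E X. g x \<in> U}" using g by (simp add: PiE_iff)
  qed
  then have "card {g \<in> I \<rightarrow>\<^sub>E X. g x \<in> U} = (\<Prod>y\<in>I. card (if y = x then U else X))"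
    by (simp add: card_PiE assms(1))
  also have "\<dots> = card U * (\<Prod>y\<in>I - {x}. card (if y = x then U else X))"
    using assms by (subst prod.remove[of I x]) auto
  also have "(\<Prod>y\<in>I - {x}. card (if y = x then U else X)) = (\<Prod>y\<in>I - {x}. card X)"
    by (intro prod.cong) auto
  finally have "card {g \<in> I \<rightarrow>\<^sub>E X. g x \<in> U} = card U * card X ^ card (I - {x})" by simp
  moreover have "card (I \<rightarrow>\<^sub>E X) = card X * card X ^ card (I - {x})"
  proof -
    have "card I = Suc (card (I - {x}))" by (rule card.remove[OF assms(1,2)])
    then show ?thesis using assms(1) by (simp only: card_PiE prod_constant power_Suc)
  qed
  ultimately show ?thesis by simp
qed

text \<open>A nonempty set of at most \<open>k\<close> indices is listed by a word of length
  \<open>k\<close>, padded with one of its elements.\<close>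

lemma card_small_subsets_le:
  assumes "k \<ge> 1"
  shows "card {I. I \<subseteq> {..<m::nat} \<and> card I \<le> k \<and> I \<noteq> {}} \<le> m ^ k"
proof -
  let ?L = "{xs. set xs \<subseteq> {..<m} \<and> length xs = k}"
  have "{I. I \<subseteq> {..<m} \<and> card I \<le> k \<and> I \<noteq> {}} \<subseteq> set ` ?L"
  proof
    fix I assume "I \<in> {I. I \<subseteq> {..<m} \<and> card I \<le> k \<and> I \<noteq> {}}"
    then have I: "I \<subseteq> {..<m}" "card I \<le> k" "I \<noteq> {}" by auto
    then obtain a where a: "a \<in> I" by auto
    have "finite I" using I(1) finite_subset by blast
    then obtain xs where xs: "set xs = I" "distinct xs" using finite_distinct_list by blast
    let ?ys = "xs @ replicate (k - card I) a"
    have "length ?ys = k" using xs I(2) distinct_card[of xs] by simp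
    moreover have "set ?ys = I" using xs a by auto
    ultimately show "I \<in> set ` ?L" using I(1) by (intro image_eqI[of _ _ ?ys]) auto
  qed
  then have "card {I. I \<subseteq> {..<m} \<and> card I \<le> k \<and> I \<noteq> {}} \<le> card ?L"
    by (rule surj_card_le[rotated]) (simp add: finite_lists_length_eq)
  then show ?thesis by (simp add: card_lists_length_eq)
qed

context
  fixes n m t :: nat and C :: "nat \<Rightarrow> nat set"
  assumes t: "t \<ge> 3"
    and C_sub: "l < m \<Longrightarrow> C l \<subseteq> {..<3 * t}" and C_card: "l < m \<Longrightarrow> card (C l) \<ge> t"
    and C_pair: "2 * i + 1 < m \<Longrightarrow> \<exists>c. C (2 * i) \<inter> C (2 * i + 1) = {c}"
begin

abbreviation "label_rows \<equiv> {..<m} \<rightarrow>\<^sub>E {..<3 * t}"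

lemma card_label_rows: "card label_rows = (3 * t) ^ m"
  by (simp add: card_PiE)

lemma finite_label_rows: "finite label_rows"
  by (simp add: finite_PiE)

text \<open>An element missed by every set carries, for each of the \<open>m div 2\<close> complete
  pairs, the label of their only common cell.\<close>

lemma card_uncovered_le:
  assumes "x \<in> {1..n}"
  shows "real (card {g \<in> labellings n m t. \<forall>l<m. g x (l div 2) \<in> C l})
    \<le> card (labellings n m t) / real (3 * t) ^ (m div 2)"
proof -
  define c where "c i = (THE c. C (2 * i) \<inter> C (2 * i + 1) = {c})" for i
  have c: "C (2 * i) \<inter> C (2 * i + 1) = {c i}" if "i < m div 2" for i
  proof -
    have "2 * i + 1 < m" using that by linarith
    then obtain d where d: "C (2 * i) \<inter> C (2 * i + 1) = {d}" using C_pair by blast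
    then have "c i = d" unfolding c_def by (intro the_equality) auto
    then show ?thesis using d by simp
  qed
  \<comment> \<open>The rows whose labels are pinned to the common cell of every complete
    pair.\<close>
  define U where "U = (\<Pi>\<^sub>E i\<in>{..<m}. if i < m div 2 then {c i} else {..<3 * t})"
  have c_less: "c i < 3 * t" if "i < m div 2" for i
    using c[OF that] C_sub[of "2 * i"] that by fastforce
  then have U_sub: "U \<subseteq> label_rows" by (auto simp: U_def PiE_iff split: if_splits)
  have "card U = (\<Prod>i<m. card (if i < m div 2 then {c i} else {..<3 * t}))"
    by (simp add: U_def card_PiE)
  then have "card U * (3 * t) ^ (m div 2)
      = (\<Prod>i<m. if i < m div 2 then 1 else 3 * t) * (\<Prod>i<m. if i < m div 2 then 3 * t else 1)"
  proof -
    assume cU: "card U = (\<Prod>i<m. card (if i < m div 2 then {c i} else {..<3 * t}))"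
    have "(\<Prod>i<m. if i < m div 2 then 3 * t else 1) = (\<Prod>i\<in>{..<m} \<inter> {i. i < m div 2}. 3 * t)"
      by (subst prod.inter_restrict) auto
    also have "{..<m} \<inter> {i. i < m div 2} = {..<m div 2}" by auto
    finally have "(\<Prod>i<m. if i < m div 2 then 3 * t else 1) = (3 * t) ^ (m div 2)" by simp
    moreover have "(\<Prod>i<m. card (if i < m div 2 then {c i} else {..<3 * t}))
        = (\<Prod>i<m. if i < m div 2 then 1 else 3 * t)" by (intro prod.cong) auto
    ultimately show ?thesis using cU by simp
  qed
  also have "\<dots> = (\<Prod>i<m. 3 * t)"
    unfolding prod.distrib[symmetric] by (intro prod.cong) auto
  finally have cardU: "card U * (3 * t) ^ (m div 2) = card label_rows" by (simp add: card_label_rows)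
  have "card {g \<in> labellings n m t. g x \<in> U} * card label_rows = card U * card (labellings n m t)"
    unfolding labellings_def by (rule card_PiE_constrained[OF _ assms U_sub finite_label_rows]) simp
  then have "card {g \<in> labellings n m t. g x \<in> U} * (card U * (3 * t) ^ (m div 2))
      = card U * card (labellings n m t)" by (simp only: cardU)
  moreover have "card U > 0" using cardU t by (auto simp: card_label_rows intro!: Nat.gr0I)
  ultimately have "card {g \<in> labellings n m t. g x \<in> U} * (3 * t) ^ (m div 2) = card (labellings n m t)"
    by (metis (no_types, lifting) mult.left_commute nat_mult_eq_cancel1)
  then have "real (card {g \<in> labellings n m t. g x \<in> U}) * real (3 * t) ^ (m div 2)
      = card (labellings n m t)"
    by (simp only: of_nat_mult[symmetric] of_nat_power[symmetric])
  then have eq: "real (card {g \<in> labellings n m t. g x \<in> U})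
      = card (labellings n m t) / real (3 * t) ^ (m div 2)"
    using t by (simp add: field_simps)
  have "{g \<in> labellings n m t. \<forall>l<m. g x (l div 2) \<in> C l} \<subseteq> {g \<in> labellings n m t. g x \<in> U}"
  proof clarify
    fix g assume g: "g \<in> labellings n m t" "\<forall>l<m. g x (l div 2) \<in> C l"
    have gx: "g x \<in> label_rows" using g(1) assms by (auto simp: labellings_def)
    have "g x i = c i" if i: "i < m div 2" for i
    proof -
      have "2 * i < m" "2 * i + 1 < m" using i by auto
      then have "g x (2 * i div 2) \<in> C (2 * i)" "g x ((2 * i + 1) div 2) \<in> C (2 * i + 1)" using g(2) by blast+
      then have "g x i \<in> C (2 * i) \<inter> C (2 * i + 1)" by simp
      then show ?thesis unfolding c[OF i] by (rule singletonD)
    qed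
    then show "g x \<in> U" using gx by (auto simp: U_def PiE_iff)
  qed
  then have "card {g \<in> labellings n m t. \<forall>l<m. g x (l div 2) \<in> C l} \<le> card {g \<in> labellings n m t. g x \<in> U}"
    by (rule card_mono[rotated]) (simp add: finite_labellings)
  then show ?thesis unfolding eq[symmetric] by simp
qed

text \<open>Every set in \<open>I\<close> costs at most a factor \<open>sqrt (3 * t)\<close>. A lone
  member keeps a third of the cells, which suffices because \<open>3 * t \<ge> 9\<close>; a full
  pair keeps one cell out of \<open>3 * t\<close>, a factor of exactly \<open>sqrt (3 * t)\<close>
  per member.\<close>

lemma card_hit_ge:
  assumes I: "I \<subseteq> {..<m}"
  shows "real (card {h \<in> label_rows. \<forall>l\<in>I. h (l div 2) \<in> C l}) \<ge> real (3 * t) ^ m / sqrt (real (3 * t)) ^ card I"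
proof -
  let ?T = "real (3 * t)"
  define q where "q = sqrt ?T"
  have q3: "q \<ge> 3" unfolding q_def using t by (intro real_le_rsqrt) simp
  have qq: "q * q = ?T" unfolding q_def by simp
  define V where "V i = {b \<in> {..<3 * t}. \<forall>l\<in>I. l div 2 = i \<longrightarrow> b \<in> C l}" for i
  have finI: "finite I" using I finite_subset by blast
  have "{h \<in> label_rows. \<forall>l\<in>I. h (l div 2) \<in> C l} = PiE {..<m} V"
  proof (intro equalityI subsetI)
    fix h assume "h \<in> {h \<in> label_rows. \<forall>l\<in>I. h (l div 2) \<in> C l}"
    then show "h \<in> PiE {..<m} V" by (auto simp: V_def PiE_iff)
  next
    fix h assume h: "h \<in> PiE {..<m} V"
    have "h (l div 2) \<in> C l" if l: "l \<in> I" for l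
    proof -
      have "l div 2 < m" using l I by auto
      then have "h (l div 2) \<in> V (l div 2)" using PiE_mem[OF h] by simp
      then show ?thesis using l by (simp add: V_def)
    qed
    moreover have "h \<in> label_rows" using h by (auto simp: V_def PiE_iff)
    ultimately show "h \<in> {h \<in> label_rows. \<forall>l\<in>I. h (l div 2) \<in> C l}" by blast
  qed
  then have "real (card {h \<in> label_rows. \<forall>l\<in>I. h (l div 2) \<in> C l}) = (\<Prod>i<m. real (card (V i)))"
    by (simp add: card_PiE)
  moreover have V_ge: "real (card (V i)) \<ge> ?T / q ^ card (I \<inter> {2 * i, 2 * i + 1})" for i
  proof -
    have mem: "(\<forall>l\<in>I. l div 2 = i \<longrightarrow> b \<in> C l) \<longleftrightarrow>
        (2 * i \<in> I \<longrightarrow> b \<in> C (2 * i)) \<and> (2 * i + 1 \<in> I \<longrightarrow> b \<in> C (2 * i + 1))" for b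
      unfolding div_2_eq_iff by blast
    have T_q: "?T / q = q" using qq q3 by (simp add: field_simps)
    have T3: "real t \<ge> q"
    proof -
      have "3 * q \<le> q * q" using q3 by (intro mult_right_mono) auto
      then show ?thesis using qq by simp
    qed
    consider (none) "2 * i \<notin> I" "2 * i + 1 \<notin> I" | (fst) "2 * i \<in> I" "2 * i + 1 \<notin> I"
      | (snd) "2 * i \<notin> I" "2 * i + 1 \<in> I" | (both) "2 * i \<in> I" "2 * i + 1 \<in> I" by blast
    then show ?thesis
    proof cases
      case none
      then have "V i = {..<3 * t}" unfolding V_def mem by auto
      then show ?thesis using none by simp
    next
      case fst
      then have "V i = C (2 * i)" unfolding V_def mem using C_sub[of "2 * i"] I by auto
      then have "real (card (V i)) \<ge> real t" using C_card[of "2 * i"] fst I by auto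
      moreover have "I \<inter> {2 * i, 2 * i + 1} = {2 * i}" using fst by auto
      ultimately show ?thesis using T3 T_q by simp
    next
      case snd
      then have "V i = C (2 * i + 1)" unfolding V_def mem using C_sub[of "2 * i + 1"] I by auto
      then have "real (card (V i)) \<ge> real t" using C_card[of "2 * i + 1"] snd I by auto
      moreover have "I \<inter> {2 * i, 2 * i + 1} = {2 * i + 1}" using snd by auto
      ultimately show ?thesis using T3 T_q by simp
    next
      case both
      then have im: "2 * i + 1 < m" using I by auto
      have "V i = C (2 * i) \<inter> C (2 * i + 1)"
        unfolding V_def mem using both C_sub[of "2 * i"] im by auto
      then have "card (V i) = 1" using C_pair[OF im] by auto
      moreover have "I \<inter> {2 * i, 2 * i + 1} = {2 * i, 2 * i + 1}" using both by auto
      ultimately show ?thesis using qq q3 t by (simp add: power2_eq_square)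
    qed
  qed
  have "(\<Prod>i<m. ?T / q ^ card (I \<inter> {2 * i, 2 * i + 1})) \<le> (\<Prod>i<m. real (card (V i)))"
    using V_ge q3 by (intro prod_mono) auto
  moreover have "(\<Prod>i<m. ?T / q ^ card (I \<inter> {2 * i, 2 * i + 1})) = ?T ^ m / q ^ card I"
  proof -
    have "(\<Sum>i<m. card (I \<inter> {2 * i, 2 * i + 1})) = card (\<Union>i<m. I \<inter> {2 * i, 2 * i + 1})"
      using finI by (intro card_UN_disjoint[symmetric]) auto
    also have "(\<Union>i<m. I \<inter> {2 * i, 2 * i + 1}) = I"
    proof (intro equalityI subsetI)
      fix l assume l: "l \<in> I"
      then have "l div 2 < m" using I by auto
      moreover have "l = 2 * (l div 2) \<or> l = 2 * (l div 2) + 1" by presburger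
      ultimately show "l \<in> (\<Union>i<m. I \<inter> {2 * i, 2 * i + 1})" using l by blast
    qed auto
    finally have "(\<Prod>i<m. q ^ card (I \<inter> {2 * i, 2 * i + 1})) = q ^ card I"
      by (simp only: power_sum[symmetric])
    then show ?thesis by (simp add: prod_dividef)
  qed
  ultimately show ?thesis by (simp only: q_def)
qed

text \<open>A union bound over uncovered elements and over families \<open>I\<close>. For a fixed
  \<open>I\<close> the rows of the \<open>n\<close> elements are independent and each is missed with
  probability at least \<open>1 / q ^ k\<close>, so covering all of them has probability at most
  \<open>exp (- (n / q ^ k))\<close>.\<close>

lemma card_degenerate_le:
  assumes "n \<ge> 1" "k \<ge> 1"
  shows "real (card {g \<in> labellings n m t. degenerate n m k C g})
    \<le> card (labellings n m t) *
       (n / real (3 * t) ^ (m div 2) + real m ^ k * exp (- (n / sqrt (real (3 * t)) ^ k)))"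
proof -
  let ?G = "labellings n m t" and ?T = "real (3 * t)"
  let ?\<I> = "{I. I \<subseteq> {..<m} \<and> card I \<le> k \<and> I \<noteq> {}}"
  define q where "q = sqrt ?T"
  have q1: "q \<ge> 1" unfolding q_def using t by simp
  have cardG: "real (card ?G) = (?T ^ m) ^ n"
    by (simp add: labellings_def card_PiE)
  have small: "real (card {g \<in> ?G. \<forall>x\<in>{1..n}. \<exists>l\<in>I. g x (l div 2) \<notin> C l})
      \<le> card ?G * exp (- (n / q ^ k))" if "I \<in> ?\<I>" for I
  proof -
    have I: "I \<subseteq> {..<m}" "card I \<le> k" using that by auto
    let ?hit = "{h \<in> label_rows. \<forall>l\<in>I. h (l div 2) \<in> C l}"
    have "{g \<in> ?G. \<forall>x\<in>{1..n}. \<exists>l\<in>I. g x (l div 2) \<notin> C l} = {1..n} \<rightarrow>\<^sub>E (label_rows - ?hit)"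
    proof (intro equalityI subsetI)
      fix g assume g: "g \<in> {g \<in> ?G. \<forall>x\<in>{1..n}. \<exists>l\<in>I. g x (l div 2) \<notin> C l}"
      then have "g x \<in> label_rows - ?hit" if "x \<in> {1..n}" for x
        using that PiE_mem[of g "{1..n}" "\<lambda>_. label_rows" x] unfolding labellings_def by blast
      moreover have "g \<in> extensional {1..n}" using g by (simp add: labellings_def PiE_def)
      ultimately show "g \<in> {1..n} \<rightarrow>\<^sub>E (label_rows - ?hit)" unfolding PiE_iff[of g] by blast
    next
      fix g assume g: "g \<in> {1..n} \<rightarrow>\<^sub>E (label_rows - ?hit)"
      then have "g x \<in> label_rows - ?hit" if "x \<in> {1..n}" for x using that by (rule PiE_mem)
      moreover have "g \<in> extensional {1..n}" using g by (simp add: PiE_def)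
      ultimately have "g \<in> ?G" unfolding labellings_def PiE_iff[of g] by blast
      moreover have "\<exists>l\<in>I. g x (l div 2) \<notin> C l" if "x \<in> {1..n}" for x
        using PiE_mem[OF g that] by blast
      ultimately show "g \<in> {g \<in> ?G. \<forall>x\<in>{1..n}. \<exists>l\<in>I. g x (l div 2) \<notin> C l}" by blast
    qed
    then have "card {g \<in> ?G. \<forall>x\<in>{1..n}. \<exists>l\<in>I. g x (l div 2) \<notin> C l} = card (label_rows - ?hit) ^ n"
      by (simp only: card_PiE finite_atLeastAtMost) simp
    moreover have "real (card (label_rows - ?hit)) = ?T ^ m - real (card ?hit)"
    proof -
      have "card ?hit \<le> card label_rows" by (rule card_mono) (auto simp: finite_label_rows)
      moreover have "card (label_rows - ?hit) = card label_rows - card ?hit"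
        by (rule card_Diff_subset) (auto intro: finite_subset[OF _ finite_label_rows])
      ultimately show ?thesis by (simp add: card_label_rows of_nat_diff)
    qed
    moreover have "\<dots> \<le> ?T ^ m * exp (- (1 / q ^ k))"
    proof -
      have "?T ^ m / q ^ k \<le> ?T ^ m / q ^ card I"
        using q1 I(2) by (intro divide_left_mono power_increasing mult_pos_pos) auto
      also have "\<dots> \<le> real (card ?hit)" using card_hit_ge[OF I(1)] by (simp add: q_def)
      finally have "?T ^ m - real (card ?hit) \<le> ?T ^ m * (1 + - (1 / q ^ k))" by (simp add: algebra_simps)
      also have "\<dots> \<le> ?T ^ m * exp (- (1 / q ^ k))"
        by (intro mult_left_mono exp_ge_add_one_self) auto
      finally show ?thesis .
    qed
    ultimately have "real (card {g \<in> ?G. \<forall>x\<in>{1..n}. \<exists>l\<in>I. g x (l div 2) \<notin> C l})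
        \<le> (?T ^ m * exp (- (1 / q ^ k))) ^ n"
      using power_mono[of "real (card (label_rows - ?hit))" "?T ^ m * exp (- (1 / q ^ k))" n] by simp
    also have "\<dots> = card ?G * exp (- (n / q ^ k))"
      by (simp add: cardG power_mult_distrib exp_of_nat_mult[symmetric])
    finally show ?thesis .
  qed
  have fin: "finite ?\<I>" by (rule finite_subset[of _ "Pow {..<m}"]) auto
  have "{g \<in> ?G. degenerate n m k C g}
      \<subseteq> (\<Union>x\<in>{1..n}. {g \<in> ?G. \<forall>l<m. g x (l div 2) \<in> C l})
        \<union> (\<Union>I\<in>?\<I>. {g \<in> ?G. \<forall>x\<in>{1..n}. \<exists>l\<in>I. g x (l div 2) \<notin> C l})"
  proof
    fix g assume "g \<in> {g \<in> ?G. degenerate n m k C g}"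
    then have g: "g \<in> ?G" and deg: "degenerate n m k C g" by auto
    from deg show "g \<in> (\<Union>x\<in>{1..n}. {g \<in> ?G. \<forall>l<m. g x (l div 2) \<in> C l})
        \<union> (\<Union>I\<in>?\<I>. {g \<in> ?G. \<forall>x\<in>{1..n}. \<exists>l\<in>I. g x (l div 2) \<notin> C l})"
      unfolding degenerate_def
    proof (elim disjE bexE exE conjE)
      fix I assume I: "I \<subseteq> {..<m}" "card I \<le> k" "\<forall>x\<in>{1..n}. \<exists>l\<in>I. g x (l div 2) \<notin> C l"
      have "I \<noteq> {}" using I(3) assms(1) by force
      then have "I \<in> ?\<I>" using I by blast
      then show ?thesis using I(3) g by blast
    qed (use g in blast)
  qed
  then have "card {g \<in> ?G. degenerate n m k C g}
      \<le> card ((\<Union>x\<in>{1..n}. {g \<in> ?G. \<forall>l<m. g x (l div 2) \<in> C l})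
        \<union> (\<Union>I\<in>?\<I>. {g \<in> ?G. \<forall>x\<in>{1..n}. \<exists>l\<in>I. g x (l div 2) \<notin> C l}))"
    by (rule card_mono[rotated]) (use fin in \<open>auto simp: finite_labellings\<close>)
  also have "\<dots> \<le> (\<Sum>x\<in>{1..n}. card {g \<in> ?G. \<forall>l<m. g x (l div 2) \<in> C l})
        + (\<Sum>I\<in>?\<I>. card {g \<in> ?G. \<forall>x\<in>{1..n}. \<exists>l\<in>I. g x (l div 2) \<notin> C l})"
    by (intro order_trans[OF card_Un_le] add_mono card_UN_le fin) auto
  finally have "real (card {g \<in> ?G. degenerate n m k C g})
      \<le> (\<Sum>x\<in>{1..n}. real (card {g \<in> ?G. \<forall>l<m. g x (l div 2) \<in> C l}))
        + (\<Sum>I\<in>?\<I>. real (card {g \<in> ?G. \<forall>x\<in>{1..n}. \<exists>l\<in>I. g x (l div 2) \<notin> C l}))"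
    unfolding of_nat_sum[symmetric] of_nat_add[symmetric] of_nat_le_iff .
  also have "\<dots> \<le> (\<Sum>x\<in>{1..n}. card ?G / ?T ^ (m div 2)) + (\<Sum>I\<in>?\<I>. card ?G * exp (- (n / q ^ k)))"
    by (intro add_mono sum_mono card_uncovered_le small) auto
  also have "\<dots> = n * (card ?G / ?T ^ (m div 2)) + card ?\<I> * (card ?G * exp (- (n / q ^ k)))"
    by simp
  also have "\<dots> \<le> n * (card ?G / ?T ^ (m div 2)) + real m ^ k * (card ?G * exp (- (n / q ^ k)))"
  proof -
    have "card ?\<I> \<le> m ^ k" by (rule card_small_subsets_le[OF assms(2)])
    then have "real (card ?\<I>) \<le> real m ^ k" by (simp only: of_nat_power[symmetric] of_nat_le_iff)
    then show ?thesis by (intro add_left_mono mult_right_mono) auto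
  qed
  finally show ?thesis by (simp only: q_def) (simp add: algebra_simps)
qed

end

text \<open>Averaging: each sample is spoiled by at most 1/32 + 1/32 of the labellings, so some
  labelling spoils at most 1/16 of the samples.\<close>

lemma exists_good_labelling:
  assumes "n \<ge> 1" "k \<ge> 1" "t \<ge> 3"
    and "n / real (3 * t) ^ (m div 2) \<le> 1/32" "real m ^ k * exp (- (n / sqrt (real (3 * t)) ^ k)) \<le> 1/32"
  obtains g where "real (card {\<xi> \<in> samples m t. degenerate n m k (no_cells t \<xi>) g})
    \<le> card (samples m t) / 16"
proof -
  let ?G = "labellings n m t"
  have deg: "real (card {g \<in> ?G. degenerate n m k (no_cells t \<xi>) g}) \<le> card ?G / 16"
    if "\<xi> \<in> samples m t" for \<xi>
  proof -
    have "real (card {g \<in> ?G. degenerate n m k (no_cells t \<xi>) g}) \<le> card ?G *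
       (n / real (3 * t) ^ (m div 2) + real m ^ k * exp (- (n / sqrt (real (3 * t)) ^ k)))"
      by (rule card_degenerate_le) (use assms no_cells_props[OF that] in auto)
    also have "\<dots> \<le> card ?G * (1/32 + 1/32)"
      using assms by (intro mult_left_mono add_mono) auto
    finally show ?thesis by simp
  qed
  have "\<exists>g\<in>?G. real (card {\<xi> \<in> samples m t. degenerate n m k (no_cells t \<xi>) g}) \<le> card (samples m t) / 16"
  proof (rule ccontr)
    assume neg: "\<not> ?thesis"
    have "{..<3 * t} \<noteq> {}" using assms(3) by (simp add: lessThan_empty_iff)
    then have G_ne: "?G \<noteq> {}" by (simp add: labellings_def PiE_eq_empty_iff)
    let ?d = "\<lambda>\<xi> g. of_bool (degenerate n m k (no_cells t \<xi>) g) :: real"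
    have "card ?G * (card (samples m t) / 16) = (\<Sum>g\<in>?G. card (samples m t) / 16)" by simp
    also have "\<dots> < (\<Sum>g\<in>?G. real (card {\<xi> \<in> samples m t. degenerate n m k (no_cells t \<xi>) g}))"
      using neg G_ne by (intro sum_strict_mono finite_labellings) auto
    also have "\<dots> = (\<Sum>g\<in>?G. \<Sum>\<xi>\<in>samples m t. ?d \<xi> g)"
      by (simp add: finite_samples Int_def)
    also have "\<dots> = (\<Sum>\<xi>\<in>samples m t. \<Sum>g\<in>?G. ?d \<xi> g)" by (rule sum.swap)
    also have "\<dots> = (\<Sum>\<xi>\<in>samples m t. real (card {g \<in> ?G. degenerate n m k (no_cells t \<xi>) g}))"
      by (simp add: finite_labellings Int_def)
    also have "\<dots> \<le> (\<Sum>\<xi>\<in>samples m t. card ?G / 16)" by (intro sum_mono deg)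
    finally show False by simp
  qed
  then show ?thesis using that by blast
qed

subsection \<open>The lower bound\<close>

lemma prob_pair_pmf_of_set:
  assumes "finite P" "P \<noteq> {}"
  shows "measure_pmf.prob (pair_pmf (pmf_of_set P) R) X
       = (\<Sum>\<pi>\<in>P. measure_pmf.prob R {r. (\<pi>, r) \<in> X}) / card P"
proof -
  have "emeasure (pair_pmf (pmf_of_set P) R) X
      = (\<integral>\<^sup>+\<pi>. \<integral>\<^sup>+r. indicator X (\<pi>, r) \<partial>R \<partial>pmf_of_set P)"
    by (subst nn_integral_pair_pmf'[symmetric]) simp
  also have "\<dots> = (\<integral>\<^sup>+\<pi>. ennreal (measure_pmf.prob R {r. (\<pi>, r) \<in> X}) \<partial>pmf_of_set P)"
  proof (rule nn_integral_cong)
    fix \<pi>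
    have "(\<integral>\<^sup>+r. indicator X (\<pi>, r) \<partial>R) = (\<integral>\<^sup>+r. indicator {r. (\<pi>, r) \<in> X} r \<partial>R)"
      by (intro nn_integral_cong) (simp add: indicator_def)
    then show "(\<integral>\<^sup>+r. indicator X (\<pi>, r) \<partial>R) = ennreal (measure_pmf.prob R {r. (\<pi>, r) \<in> X})"
      by (simp add: measure_pmf.emeasure_eq_measure)
  qed
  also have "\<dots> = (\<Sum>\<pi>\<in>P. ennreal (measure_pmf.prob R {r. (\<pi>, r) \<in> X})) / card P"
    using assms by (simp add: nn_integral_pmf_of_set)
  also have "\<dots> = ennreal ((\<Sum>\<pi>\<in>P. measure_pmf.prob R {r. (\<pi>, r) \<in> X}) / card P)"
    using assms by (simp add: sum_ennreal divide_ennreal sum_nonneg card_gt_0_iff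
        ennreal_of_nat_eq_real_of_nat)
  finally show ?thesis
    by (simp add: measure_pmf.emeasure_eq_measure sum_nonneg)
qed

lemma prob_eq_expectation_of_bool:
  "measure_pmf.prob R {r. Q r} = measure_pmf.expectation R (\<lambda>r. of_bool (Q r))"
proof -
  have "measure_pmf.expectation R (\<lambda>r. of_bool (Q r) :: real) = measure_pmf.expectation R (indicator {r. Q r} :: _ \<Rightarrow> real)"
    by (intro Bochner_Integration.integral_cong) (auto simp: indicator_def)
  then show ?thesis by simp
qed

lemma integrable_of_bool: "integrable (measure_pmf R) (\<lambda>r. of_bool (Q r) :: real)"
  by (rule measure_pmf.integrable_const_bound[where B = 1]) auto

text \<open>Accepting means that the output is at most \<open>2 * \<alpha>\<close>. Correctness
  forces an acceptance gap of 7/16 between yes and no instances. Unsplit pairs and the additive loss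
  explain only 1/3 + 1/16 of it; the remaining 1/24 must come from influences, which the number of
  transcripts bounds.\<close>

lemma space_lower_bound:
  fixes \<alpha> :: real and n m t p s :: nat
  assumes n: "n \<ge> 1" and m: "m \<ge> 4" and t: "t \<ge> 3" and \<alpha>: "\<alpha> \<ge> 1" and p: "p \<ge> 1"
    and uncov: "n / real (3 * t) ^ (m div 2) \<le> 1/32"
    and small: "real m ^ nat \<lfloor>2 * \<alpha>\<rfloor> * exp (- (n / sqrt (real (3 * t)) ^ nat \<lfloor>2 * \<alpha>\<rfloor>)) \<le> 1/32"
    and space: "uses_space A s"
    and succ: "\<And>S. is_instance n m S \<Longrightarrow> success_prob A R p n S \<alpha> > 3/4"
  shows "real (m div 2) * real (t - 1) \<le> 6291456 * real p * real s"
proof -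
  \<comment> \<open>An optimum above \<open>k\<close> is at least \<open>k + 1\<close> and hence
    exceeds \<open>2 * \<alpha>\<close>.\<close>
  define k where "k = nat \<lfloor>2 * \<alpha>\<rfloor>"
  have k: "k \<ge> 1" "2 * \<alpha> < real k + 1" unfolding k_def using \<alpha> by linarith+
  obtain g where g: "real (card {\<xi> \<in> samples m t. degenerate n m k (no_cells t \<xi>) g}) \<le> card (samples m t) / 16"
    using exists_good_labelling[OF n k(1) t uncov small[folded k_def]] by blast
  let ?P = "{\<pi>. \<pi> permutes {..<m}}"
  have finP: "finite ?P" by (simp add: finite_permutations)
  have cardP: "card ?P = fact m" by (simp add: card_permutations)
  have P_ne: "?P \<noteq> {}" using permutes_id by blast
  define inst where "inst C = map (cutset n g C) [0..<m]" for C
  define acc where "acc C r \<pi> \<longleftrightarrow> alg_output A r p (random_order (inst C) \<pi>) \<le> 2 * \<alpha>" for C r \<pi>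
  define a where "a C = measure_pmf.prob (pair_pmf (order_dist m) R) {(\<pi>, r). acc C r \<pi>}" for C
  have len: "length (inst C) = m" for C by (simp add: inst_def)
  have yes: "a (yes_cells t \<xi>) \<ge> 3/4" if "\<xi> \<in> samples m t" for \<xi>
  proof -
    let ?S = "inst (yes_cells t \<xi>)"
    have opt: "set_cover_opt n ?S \<le> 2" and inst: "is_instance n m ?S"
      using yes_instance[OF that] by (simp_all add: inst_def)
    have "\<alpha> * real (set_cover_opt n ?S) \<le> \<alpha> * 2" using opt \<alpha> by (intro mult_left_mono) auto
    then have "success_prob A R p n ?S \<alpha> \<le> a (yes_cells t \<xi>)"
      unfolding success_prob_def a_def len acc_def by (intro measure_pmf.finite_measure_mono) auto
    then show ?thesis using succ[OF inst] by simp
  qed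
  have no: "a (no_cells t \<xi>) \<le> 1/4" if "\<not> degenerate n m k (no_cells t \<xi>) g" for \<xi>
  proof -
    let ?S = "inst (no_cells t \<xi>)"
    let ?M = "pair_pmf (order_dist m) R"
    let ?X = "{(\<pi>, r). real (set_cover_opt n ?S) \<le> alg_output A r p (random_order ?S \<pi>) \<and>
                alg_output A r p (random_order ?S \<pi>) \<le> \<alpha> * real (set_cover_opt n ?S)}"
    have opt: "set_cover_opt n ?S > k" and inst: "is_instance n m ?S"
      using not_degenerate[OF that] by (simp_all add: inst_def)
    have "2 * \<alpha> < real (set_cover_opt n ?S)" using opt k(2) by linarith
    then have "{(\<pi>, r). acc (no_cells t \<xi>) r \<pi>} \<subseteq> - ?X" unfolding acc_def by auto
    then have "a (no_cells t \<xi>) \<le> measure_pmf.prob ?M (- ?X)"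
      unfolding a_def by (intro measure_pmf.finite_measure_mono) auto
    also have "\<dots> = 1 - measure_pmf.prob ?M ?X"
      using measure_pmf.prob_compl[of ?X ?M] by (simp add: Compl_eq_Diff_UNIV)
    also have "measure_pmf.prob ?M ?X = success_prob A R p n ?S \<alpha>" by (simp add: success_prob_def len)
    finally show ?thesis using succ[OF inst] by simp
  qed
  have a_le: "a C \<le> 1" for C unfolding a_def by simp
  let ?N = "real (card (samples m t))"
  \<comment> \<open>A sample contributes 3/4 - 1/4, reduced by 1 if degenerate; at most 1/16 of the
    samples are.\<close>
  have lower: "7/16 * ?N \<le> (\<Sum>\<xi>\<in>samples m t. a (yes_cells t \<xi>) - a (no_cells t \<xi>))"
  proof -
    have "3/4 * ?N - 1/4 * ?N - real (card {\<xi> \<in> samples m t. degenerate n m k (no_cells t \<xi>) g})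
      = (\<Sum>\<xi>\<in>samples m t. 3/4 - (1/4 + of_bool (degenerate n m k (no_cells t \<xi>) g)))"
      by (simp add: sum_subtractf sum.distrib finite_samples Int_def)
    also have "\<dots> \<le> (\<Sum>\<xi>\<in>samples m t. a (yes_cells t \<xi>) - a (no_cells t \<xi>))"
    proof (intro sum_mono diff_mono yes)
      fix \<xi>
      show "a (no_cells t \<xi>) \<le> 1/4 + of_bool (degenerate n m k (no_cells t \<xi>) g)"
        using no[of \<xi>] a_le[of "no_cells t \<xi>"] by (cases "degenerate n m k (no_cells t \<xi>) g") auto
    qed
    finally show ?thesis using g by simp
  qed
  define K where "K = (2 ^ card (bits m t) :: real)"
  define E where "E = real (card ({..<m} \<rightarrow>\<^sub>E {..<t}))"
  define lnQ where "lnQ = ln (card (transcripts m p s))"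
  define U where "U = fact m * (K * (real (m div 2) * card (pairs t) * (K * E) * (1/3 + 1/16))
      + K * (K * E * (32768 * t * lnQ)))"
  have N: "?N = real (m div 2) * card (pairs t) * K * E * K"
    by (simp add: samples_def card_cartesian_product card_Pow finite_bits K_def E_def)
  have KE: "K > 0" "E > 0"
    using t by (simp_all add: K_def E_def card_PiE)
  define F where "F r = (\<Sum>\<xi>\<in>samples m t. \<Sum>\<pi>\<in>?P. of_bool (acc (yes_cells t \<xi>) r \<pi>)
      - of_bool (acc (no_cells t \<xi>) r \<pi>) :: real)" for r
  \<comment> \<open>The bound holds for every seed, so averaging over \<open>R\<close> at the end is
    free. For a given seed the order is summed outermost, which lets
    \<open>same_block_permutations_le\<close> average out the unsplit pairs.\<close>
  have F_le: "F r \<le> U" for r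
  proof -
    have "F r = (\<Sum>\<pi>\<in>?P. \<Sum>\<xi>\<in>samples m t. of_bool (acc (yes_cells t \<xi>) r \<pi>)
      - of_bool (acc (no_cells t \<xi>) r \<pi>))"
      unfolding F_def by (rule sum.swap)
    also have "\<dots> \<le> (\<Sum>\<pi>\<in>?P. K * (\<Sum>i<m div 2. card (pairs t) * (K * E) *
          (of_bool (block m (inv \<pi> (2 * i)) = block m (inv \<pi> (2 * i + 1))) + 1/16))
        + K * (K * E * (32768 * t * lnQ)))"
    proof (rule sum_mono)
      fix \<pi> assume "\<pi> \<in> ?P"
      then interpret streamed A r m p s t n g \<pi> "2 * \<alpha>"
        using space m p by unfold_locales auto
      show "(\<Sum>\<xi>\<in>samples m t. of_bool (acc (yes_cells t \<xi>) r \<pi>) - of_bool (acc (no_cells t \<xi>) r \<pi>))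
        \<le> K * (\<Sum>i<m div 2. card (pairs t) * (K * E) *
          (of_bool (block m (inv \<pi> (2 * i)) = block m (inv \<pi> (2 * i + 1))) + 1/16))
        + K * (K * E * (32768 * t * lnQ))"
        using sum_accept_gap_le
        unfolding accepts_def unsplit_def acc_def inst_def K_def E_def lnQ_def
        by (simp only: of_nat_mult of_nat_power of_nat_numeral)
    qed
    also have "\<dots> = K * (\<Sum>i<m div 2. card (pairs t) * (K * E) *
          ((\<Sum>\<pi>\<in>?P. of_bool (block m (inv \<pi> (2 * i)) = block m (inv \<pi> (2 * i + 1)))) + fact m * (1/16)))
        + fact m * (K * (K * E * (32768 * t * lnQ)))"
    proof -
      have "(\<Sum>\<pi>\<in>?P. K * (\<Sum>i<m div 2. c * (b i \<pi> + 1/16)) + d)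
          = K * (\<Sum>i<m div 2. c * ((\<Sum>\<pi>\<in>?P. b i \<pi>) + fact m * (1/16))) + fact m * d"
        for c d :: real and b :: "nat \<Rightarrow> (nat \<Rightarrow> nat) \<Rightarrow> real"
      proof -
        have "(\<Sum>\<pi>\<in>?P. K * (\<Sum>i<m div 2. c * (b i \<pi> + 1/16)) + d)
            = K * (\<Sum>\<pi>\<in>?P. \<Sum>i<m div 2. c * (b i \<pi> + 1/16)) + fact m * d"
          by (simp only: sum.distrib sum_distrib_left[symmetric] sum_constant cardP of_nat_fact)
        also have "(\<Sum>\<pi>\<in>?P. \<Sum>i<m div 2. c * (b i \<pi> + 1/16))
            = (\<Sum>i<m div 2. \<Sum>\<pi>\<in>?P. c * (b i \<pi> + 1/16))" by (rule sum.swap)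
        also have "\<dots> = (\<Sum>i<m div 2. c * ((\<Sum>\<pi>\<in>?P. b i \<pi>) + fact m * (1/16)))"
          by (simp only: sum.distrib sum_distrib_left[symmetric] sum_constant cardP of_nat_fact)
        finally show ?thesis .
      qed
      then show ?thesis .
    qed
    also have "\<dots> \<le> K * (\<Sum>i<m div 2. card (pairs t) * (K * E) * (fact m / 3 + fact m * (1/16)))
        + fact m * (K * (K * E * (32768 * t * lnQ)))"
    proof (intro add_right_mono mult_left_mono sum_mono same_block_permutations_le)
      fix i assume "i \<in> {..<m div 2}"
      then show "2 * i < m" "2 * i + 1 < m" by auto
    qed (use KE m in auto)
    also have "\<dots> = U" by (simp add: U_def algebra_simps)
    finally show ?thesis .
  qed
  have a_eq: "a C = (\<Sum>\<pi>\<in>?P. measure_pmf.expectation R (\<lambda>r. of_bool (acc C r \<pi>))) / fact m" for C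
    unfolding a_def order_dist_def
    by (subst prob_pair_pmf_of_set[OF finP P_ne]) (simp add: cardP prob_eq_expectation_of_bool)
  have "fact m * (\<Sum>\<xi>\<in>samples m t. a (yes_cells t \<xi>) - a (no_cells t \<xi>))
      = (\<Sum>\<xi>\<in>samples m t. \<Sum>\<pi>\<in>?P. measure_pmf.expectation R (\<lambda>r. of_bool (acc (yes_cells t \<xi>) r \<pi>))
          - measure_pmf.expectation R (\<lambda>r. of_bool (acc (no_cells t \<xi>) r \<pi>)))"
  proof -
    have "fact m * a C = (\<Sum>\<pi>\<in>?P. measure_pmf.expectation R (\<lambda>r. of_bool (acc C r \<pi>)))" for C
      unfolding a_eq by simp
    then show ?thesis by (simp only: sum_distrib_left right_diff_distrib sum_subtractf)
  qed
  also have "\<dots> = (\<Sum>\<xi>\<in>samples m t. measure_pmf.expectation R (\<lambda>r. \<Sum>\<pi>\<in>?P.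
      of_bool (acc (yes_cells t \<xi>) r \<pi>) - of_bool (acc (no_cells t \<xi>) r \<pi>)))"
    by (simp only: Bochner_Integration.integral_sum Bochner_Integration.integral_diff
        Bochner_Integration.integrable_diff integrable_of_bool)
  also have "\<dots> = measure_pmf.expectation R F"
    unfolding F_def
    by (intro Bochner_Integration.integral_sum[symmetric] Bochner_Integration.integrable_sum
        Bochner_Integration.integrable_diff integrable_of_bool)
  also have "\<dots> \<le> U"
  proof (rule measure_pmf.integral_le_const)
    show "integrable (measure_pmf R) F"
      unfolding F_def by (intro Bochner_Integration.integrable_sum Bochner_Integration.integrable_diff integrable_of_bool)
  qed (use F_le in auto)
  finally have "fact m * (7/16 * ?N) \<le> U"
    using lower by (smt (verit) fact_gt_zero mult_left_mono)
  then have "7/16 * ?N \<le> K * (real (m div 2) * card (pairs t) * (K * E) * (1/3 + 1/16))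
      + K * (K * E * (32768 * t * lnQ))"
    unfolding U_def by (subst (asm) mult_le_cancel_left_pos) auto
  \<comment> \<open>7/16 - (1/3 + 1/16) = 1/24.\<close>
  then have "(K * K * E) * (real (m div 2) * card (pairs t) / 24) \<le> (K * K * E) * (32768 * t * lnQ)"
    unfolding N by (simp add: algebra_simps)
  then have "real (m div 2) * card (pairs t) / 24 \<le> 32768 * t * lnQ"
    using KE by (subst (asm) mult_le_cancel_left_pos) auto
  then have "t * (real (m div 2) * real (t - 1)) \<le> t * (786432 * lnQ)"
    using t by (simp add: card_pairs of_nat_diff algebra_simps)
  then have "real (m div 2) * real (t - 1) \<le> 786432 * lnQ"
    using t by (subst (asm) mult_le_cancel_left_pos) auto
  also have "\<dots> \<le> 786432 * (8 * real p * real s)"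
    unfolding lnQ_def using ln_card_transcripts[OF p] by (intro mult_left_mono) auto
  finally show ?thesis by simp
qed

text \<open>With \<open>3 * t\<close> close to \<open>(n / L ^ 4) powr (1 / \<alpha>)\<close>, any
  \<open>k\<close> sets leave at least \<open>L ^ 4\<close> elements uncovered in expectation. This
  beats the union bound over at most \<open>exp (2 * c2 * L\<^sup>2)\<close> families, and since
  \<open>\<alpha> \<ge> 1\<close> the loss against \<open>n powr (1 / \<alpha>)\<close> is at most
  \<open>L ^ 4\<close>.\<close>

lemma space_lower_bound_asymptotic:
  fixes \<alpha> c1 c2 :: real and n m p s :: nat
  defines "L \<equiv> ln (real n)"
  assumes m: "m \<ge> 4" and \<alpha>: "\<alpha> \<ge> 1" and p: "p \<ge> 1"
    and L: "L \<ge> 12" and lnL: "ln L \<ge> 1" and \<alpha>L: "5 * \<alpha> * ln L \<le> L"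
    and m_ge: "real n powr c1 \<le> real m" and m_le: "real m \<le> real n powr c2" and c2: "c2 > 0"
    and asym1: "2 * c2 * L\<^sup>2 + ln 32 \<le> L ^ 4"
    and asym2: "ln (32 * real n) \<le> real n powr c1 / 3"
    and space: "uses_space A s"
    and succ: "\<And>S. is_instance n m S \<Longrightarrow> success_prob A R p n S \<alpha> > 3/4"
  shows "real s \<ge> 1 / 113246208 * real m * real n powr (1 / \<alpha>) / (real p * L ^ 4)"
proof -
  have n: "real n > 0" using L unfolding L_def by (cases "n = 0") auto
  have exp_L: "exp L = real n" unfolding L_def using n by simp
  define y where "y = (real n / L ^ 4) powr (1 / \<alpha>)"
  define t where "t = nat \<lfloor>y / 3\<rfloor>"
  have y_pos: "y > 0" unfolding y_def using n L by simp
  have y_pow: "y powr \<alpha> = real n / L ^ 4" unfolding y_def using n L \<alpha> by (simp add: powr_powr)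
  have "ln y = (L - 4 * ln L) / \<alpha>"
    unfolding y_def L_def[symmetric] using n L by (simp add: ln_powr ln_div ln_realpow L_def[symmetric])
  moreover have "\<alpha> * ln L \<ge> 1 * ln L" using \<alpha> lnL by (intro mult_right_mono) auto
  ultimately have "\<alpha> * ln L \<le> \<alpha> * ln y" using \<alpha> \<alpha>L by (simp add: mult_ac)
  then have "ln y \<ge> ln L" using \<alpha> by (subst (asm) mult_le_cancel_left_pos) auto
  then have yL: "y \<ge> L" using y_pos L by (simp add: ln_le_cancel_iff)
  have y_ge: "y \<ge> real n powr (1 / \<alpha>) / L ^ 4"
  proof -
    have "(L ^ 4) powr (1 / \<alpha>) \<le> (L ^ 4) powr 1"
      using L \<alpha> by (intro powr_mono) (auto simp: one_le_power)
    then have "(L ^ 4) powr (1 / \<alpha>) \<le> L ^ 4" using L by simp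
    then have "real n powr (1 / \<alpha>) / L ^ 4 \<le> real n powr (1 / \<alpha>) / (L ^ 4) powr (1 / \<alpha>)"
      using L by (intro divide_left_mono mult_pos_pos) auto
    also have "\<dots> = y" unfolding y_def using n L by (simp add: powr_divide)
    finally show ?thesis .
  qed
  have t_bounds: "real t \<le> y / 3" "real t \<ge> y / 3 - 1" unfolding t_def using y_pos by linarith+
  then have t3: "t \<ge> 3" using yL L by linarith
  have M_ge: "real (m div 2) \<ge> real m / 3" using m by linarith
  have uncov: "real n / real (3 * t) ^ (m div 2) \<le> 1/32"
  proof -
    have "ln (32 * real n) \<le> real (m div 2)" using asym2 m_ge M_ge by linarith
    then have "exp (ln (32 * real n)) \<le> exp (real (m div 2))" by simp
    then have "32 * real n \<le> exp 1 ^ (m div 2)" using n by (simp add: exp_of_nat_mult[symmetric])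
    also have "\<dots> \<le> real (3 * t) ^ (m div 2)"
      using exp_le t3 by (intro power_mono) auto
    finally show ?thesis using t3 by (simp add: divide_le_eq)
  qed
  define k where "k = nat \<lfloor>2 * \<alpha>\<rfloor>"
  have k: "real k \<le> 2 * \<alpha>" unfolding k_def using \<alpha> by linarith
  have small: "real m ^ k * exp (- (n / sqrt (real (3 * t)) ^ k)) \<le> 1/32"
  proof -
    have "sqrt (real (3 * t)) ^ k = real (3 * t) powr (real k / 2)"
      using t3 by (simp add: powr_half_sqrt[symmetric] powr_powr powr_realpow[symmetric])
    also have "\<dots> \<le> real (3 * t) powr \<alpha>" using t3 k by (intro powr_mono) auto
    also have "\<dots> \<le> y powr \<alpha>" using t_bounds(1) \<alpha> by (intro powr_mono2) auto
    finally have "sqrt (real (3 * t)) ^ k \<le> real n / L ^ 4" unfolding y_pow .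
    then have "L ^ 4 \<le> n / sqrt (real (3 * t)) ^ k" using L n t3 by (simp add: field_simps)
    then have e: "exp (- (n / sqrt (real (3 * t)) ^ k)) \<le> exp (- (L ^ 4))" by simp
    have "ln (real m) \<le> ln (real n powr c2)" using m_le m n by (subst ln_le_cancel_iff) auto
    then have lnm: "ln (real m) \<le> c2 * L" using n by (simp add: ln_powr L_def)
    have "\<alpha> * 1 \<le> \<alpha> * (5 * ln L)" using \<alpha> lnL by (intro mult_left_mono) auto
    then have "\<alpha> \<le> L" using \<alpha>L by (simp add: mult_ac)
    then have k_L: "real k \<le> 2 * L" using k by simp
    have "real m ^ k = exp (real k * ln (real m))" using m by (simp add: exp_of_nat_mult)
    also have "\<dots> \<le> exp ((2 * L) * (c2 * L))"
      using k_L lnm L c2 m by (subst exp_le_cancel_iff, intro mult_mono) auto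
    finally have "real m ^ k \<le> exp (2 * c2 * L\<^sup>2)" by (simp add: power2_eq_square mult_ac)
    then have "real m ^ k * exp (- (n / sqrt (real (3 * t)) ^ k)) \<le> exp (2 * c2 * L\<^sup>2) * exp (- (L ^ 4))"
      using e by (intro mult_mono) auto
    also have "\<dots> = exp (2 * c2 * L\<^sup>2 - L ^ 4)" by (simp add: exp_add[symmetric])
    also have "\<dots> \<le> exp (- ln 32)" using asym1 by (subst exp_le_cancel_iff) linarith
    also have "\<dots> = 1/32" by (simp add: exp_minus)
    finally show ?thesis .
  qed
  have "real (m div 2) * real (t - 1) \<le> 6291456 * real p * real s"
    using n m t3 \<alpha> p uncov small[unfolded k_def] space succ by (intro space_lower_bound[of n m t \<alpha> p A s R]) auto
  \<comment> \<open>The final constant is \<open>3 * 6 * 6291456\<close>. The bound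
    \<open>y / 6 \<le> t - 1\<close> uses \<open>y \<ge> L \<ge> 12\<close>.\<close>
  moreover have "real m / 3 * (y / 6) \<le> real (m div 2) * real (t - 1)"
  proof (intro mult_mono M_ge)
    have "real (t - 1) = real t - 1" using t3 by simp
    then show "y / 6 \<le> real (t - 1)" using t_bounds(2) yL L by linarith
  qed (use y_pos in auto)
  ultimately have "real m * y \<le> 113246208 * real p * real s" by simp
  moreover have "real m * (real n powr (1 / \<alpha>) / L ^ 4) \<le> real m * y"
    using y_ge by (intro mult_left_mono) auto
  ultimately have "real m * (real n powr (1 / \<alpha>) / L ^ 4) \<le> 113246208 * real p * real s" by linarith
  then show ?thesis using p L by (simp add: field_simps)
qed

theorem theorem1:
  fixes \<alpha> :: "nat \<Rightarrow> real" and m :: "nat \<Rightarrow> nat"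
  assumes "\<alpha> \<in> o(\<lambda>n. ln (real n) / ln (ln (real n)))"
    and "eventually (\<lambda>n. \<alpha> n \<ge> 1) at_top"
    and "\<exists>c1 c2. c1 > 0 \<and> c2 > 0 \<and>
           eventually (\<lambda>n. real n powr c1 \<le> real (m n) \<and> real (m n) \<le> real n powr c2) at_top"
  shows "\<exists>C k. C > 0 \<and> eventually (\<lambda>n.
           \<forall>p \<ge> 1. \<forall>A R s. uses_space A s \<longrightarrow>
             (\<forall>S. is_instance n (m n) S \<longrightarrow> success_prob A R p n S (\<alpha> n) > 3/4) \<longrightarrow>
             real s \<ge> C * real (m n) * real n powr (1 / \<alpha> n) / (real p * ln (real n) ^ k)) at_top"
proof -
  obtain c1 c2 where c: "c1 > 0" "c2 > 0"
    and ev_m: "eventually (\<lambda>n. real n powr c1 \<le> real (m n) \<and> real (m n) \<le> real n powr c2) at_top"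
    using assms(3) by blast
  \<comment> \<open>The factor 1/5 gives \<open>5 * \<alpha> * ln L \<le> L\<close>, which makes the
    number of cells at least of order \<open>L\<close>.\<close>
  have ev_\<alpha>: "eventually (\<lambda>n. norm (\<alpha> n) \<le> 1/5 * norm (ln (real n) / ln (ln (real n)))) at_top"
    by (rule landau_o.smallD[OF assms(1)]) simp
  have ev_L: "eventually (\<lambda>n. ln (real n) \<ge> 12) at_top"
    and ev_lnL: "eventually (\<lambda>n. ln (ln (real n)) \<ge> 1) at_top"
    and ev1: "eventually (\<lambda>n. 2 * c2 * (ln (real n))\<^sup>2 + ln 32 \<le> ln (real n) ^ 4) at_top"
    and ev2: "eventually (\<lambda>n. ln (32 * real n) \<le> real n powr c1 / 3) at_top"
    and ev4: "eventually (\<lambda>n. real n powr c1 \<ge> 4) at_top"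
    using c by real_asymp+
  have "eventually (\<lambda>n.
           \<forall>p \<ge> 1. \<forall>A R s. uses_space A s \<longrightarrow>
             (\<forall>S. is_instance n (m n) S \<longrightarrow> success_prob A R p n S (\<alpha> n) > 3/4) \<longrightarrow>
             real s \<ge> 1 / 113246208 * real (m n) * real n powr (1 / \<alpha> n) / (real p * ln (real n) ^ 4)) at_top"
    using ev_m ev_\<alpha> ev_L ev_lnL ev1 ev2 ev4 assms(2)
  proof eventually_elim
    case (elim n)
    have "\<alpha> n \<le> 1/5 * (ln (real n) / ln (ln (real n)))" using elim by simp
    then have "5 * \<alpha> n * ln (ln (real n)) \<le> ln (real n)" using elim by (simp add: field_simps)
    moreover have "m n \<ge> 4" using elim by linarith
    ultimately show ?case
    proof (intro allI impI)
      fix p s :: nat and A R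
      assume "5 * \<alpha> n * ln (ln (real n)) \<le> ln (real n)" "m n \<ge> 4" "p \<ge> 1" "uses_space A s"
        and succ: "\<forall>S. is_instance n (m n) S \<longrightarrow> success_prob A R p n S (\<alpha> n) > 3/4"
      then show "real s \<ge> 1 / 113246208 * real (m n) * real n powr (1 / \<alpha> n) / (real p * ln (real n) ^ 4)"
        using elim c(2) by (intro space_lower_bound_asymptotic[of "m n" "\<alpha> n" p n c1 c2 A s R]) auto
    qed
  qed
  \<comment> \<open>The exponent 4 of the logarithm comes from the \<open>L ^ 4\<close> sacrificed
    in the choice of \<open>t\<close>.\<close>
  then show ?thesis by (intro exI[of _ "1 / 113246208"] exI[of _ 4]) simp
qed

end
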